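(* Let $\mathbb{C}$ be an exact category satisfying Condition P. Then the pushout of a monomorphism along an arbitrary morphism exists in $\mathbb{C}$, and the resulting pushout square is also a pullback. Moreover, monomorphisms are pushout stable in $\mathbb{C}$ (the pushout of a monomorphism along any morphism is a monomorphism).
   Context: A category is regular if it is finitely complete, admits coequalizers of kernel pairs, and its regular epimorphisms are pullback stable. A regular category is exact (in the sense of Barr) if every internal equivalence relation in it is effective, i.e. is the kernel pair of some morphism. A feeble pullback in a category with finite limits is a commutative square such that the unique induced morphism from its initial corner into the pullback is a regular epimorphism. A category $\mathbb{C}$ with finite limits is said to satisfy Condition P if: (a) finite coproducts exist in $\mathbb{C}$; (b) binary coproducts of pullback squares are pullback squares in $\mathbb{C}$ (that is, given two pullback squares, the square obtained by taking the binary coproduct of corresponding objects and morphisms is a pullback); (c) for each monomorphism $m:S\to A$ in $\mathbb{C}$, the commutative square with top $m+1_S:S+S\to A+S$, left side $[1_S,1_S]:S+S\to S$, right side $[1_A,m]:A+S\to A$ and bottom $m:S\to A$ is a pullback; (d) for each regular epimorphism $p:E\to B$ in $\mathbb{C}$, the commutative square with top $p+p:E+E\to B+B$, left side $[1_E,1_E]:E+E\to E$, right side $[1_B,1_B]:B+B\to B$ and bottom $p:E\to B$ is a feeble pullback. *)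

theory Defs
  imports Main
begin

section \<open>Categories\<close>

text \<open>Composition is in the usual (function composition) order. The operations of the record
  are total functions on the carrier types; only their values on \<open>Obj\<close> and \<open>Arr\<close> and on
  composable pairs are meaningful.\<close>

record ('o, 'a) cat =
  Obj :: "'o set"
  Arr :: "'a set"
  Dom :: "'a \<Rightarrow> 'o"
  Cod :: "'a \<Rightarrow> 'o"
  Id :: "'o \<Rightarrow> 'a"
  Comp :: "'a \<Rightarrow> 'a \<Rightarrow> 'a"  (infixr "\<cdot>\<index>" 75)

definition hom :: "('o, 'a) cat \<Rightarrow> 'o \<Rightarrow> 'o \<Rightarrow> 'a set" where
  "hom C A B = {f \<in> Arr C. Dom C f = A \<and> Cod C f = B}"

locale category =
  fixes C :: "('o, 'a) cat" (structure)
  assumes dom_obj: "f \<in> Arr C \<Longrightarrow> Dom C f \<in> Obj C"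
    and cod_obj: "f \<in> Arr C \<Longrightarrow> Cod C f \<in> Obj C"
    and id_hom: "A \<in> Obj C \<Longrightarrow> Id C A \<in> hom C A A"
    and comp_hom: "\<lbrakk>f \<in> hom C A B; g \<in> hom C B D\<rbrakk> \<Longrightarrow> g \<cdot> f \<in> hom C A D"
    and comp_id_right: "f \<in> hom C A B \<Longrightarrow> f \<cdot> Id C A = f"
    and comp_id_left: "f \<in> hom C A B \<Longrightarrow> Id C B \<cdot> f = f"
    and comp_assoc: "\<lbrakk>f \<in> hom C A B; g \<in> hom C B D; h \<in> hom C D E\<rbrakk>
      \<Longrightarrow> (h \<cdot> g) \<cdot> f = h \<cdot> (g \<cdot> f)"


section \<open>Finite limits and finite coproducts\<close>

definition is_functor ::
  "('i, 'u) cat \<Rightarrow> ('o, 'a) cat \<Rightarrow> ('i \<Rightarrow> 'o) \<Rightarrow> ('u \<Rightarrow> 'a) \<Rightarrow> bool" where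
  "is_functor J C F\<^sub>0 F\<^sub>1 \<longleftrightarrow> category J \<and> category C \<and>
     (\<forall>i \<in> Obj J. F\<^sub>0 i \<in> Obj C \<and> F\<^sub>1 (Id J i) = Id C (F\<^sub>0 i)) \<and>
     (\<forall>u \<in> Arr J. F\<^sub>1 u \<in> hom C (F\<^sub>0 (Dom J u)) (F\<^sub>0 (Cod J u))) \<and>
     (\<forall>u \<in> Arr J. \<forall>v \<in> Arr J. Cod J u = Dom J v \<longrightarrow>
        F\<^sub>1 (v \<cdot>\<^bsub>J\<^esub> u) = F\<^sub>1 v \<cdot>\<^bsub>C\<^esub> F\<^sub>1 u)"

definition is_cone ::
  "('i, 'u) cat \<Rightarrow> ('o, 'a) cat \<Rightarrow> ('i \<Rightarrow> 'o) \<Rightarrow> ('u \<Rightarrow> 'a) \<Rightarrow> 'o \<Rightarrow> ('i \<Rightarrow> 'a) \<Rightarrow> bool" where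
  "is_cone J C F\<^sub>0 F\<^sub>1 L \<pi> \<longleftrightarrow> L \<in> Obj C \<and>
     (\<forall>i \<in> Obj J. \<pi> i \<in> hom C L (F\<^sub>0 i)) \<and>
     (\<forall>u \<in> Arr J. F\<^sub>1 u \<cdot>\<^bsub>C\<^esub> \<pi> (Dom J u) = \<pi> (Cod J u))"

definition is_limit ::
  "('i, 'u) cat \<Rightarrow> ('o, 'a) cat \<Rightarrow> ('i \<Rightarrow> 'o) \<Rightarrow> ('u \<Rightarrow> 'a) \<Rightarrow> 'o \<Rightarrow> ('i \<Rightarrow> 'a) \<Rightarrow> bool" where
  "is_limit J C F\<^sub>0 F\<^sub>1 L \<pi> \<longleftrightarrow> is_cone J C F\<^sub>0 F\<^sub>1 L \<pi> \<and>
     (\<forall>T \<tau>. is_cone J C F\<^sub>0 F\<^sub>1 T \<tau> \<longrightarrow>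
        (\<exists>!h. h \<in> hom C T L \<and> (\<forall>i \<in> Obj J. \<pi> i \<cdot>\<^bsub>C\<^esub> h = \<tau> i)))"

text \<open>Every finite category is isomorphic to one whose objects and arrows are natural numbers,
  so it suffices to quantify over index categories of that type.\<close>

definition finitely_complete :: "('o, 'a) cat \<Rightarrow> bool" where
  "finitely_complete C \<longleftrightarrow>
     (\<forall>(J :: (nat, nat) cat) F\<^sub>0 F\<^sub>1. finite (Obj J) \<and> finite (Arr J) \<and> is_functor J C F\<^sub>0 F\<^sub>1 \<longrightarrow>
        (\<exists>L \<pi>. is_limit J C F\<^sub>0 F\<^sub>1 L \<pi>))"

definition is_coproduct ::
  "('o, 'a) cat \<Rightarrow> 'i set \<Rightarrow> ('i \<Rightarrow> 'o) \<Rightarrow> 'o \<Rightarrow> ('i \<Rightarrow> 'a) \<Rightarrow> bool" where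
  "is_coproduct C I X Q \<iota> \<longleftrightarrow> Q \<in> Obj C \<and> (\<forall>k \<in> I. \<iota> k \<in> hom C (X k) Q) \<and>
     (\<forall>T \<in> Obj C. \<forall>\<tau>. (\<forall>k \<in> I. \<tau> k \<in> hom C (X k) T) \<longrightarrow>
        (\<exists>!h. h \<in> hom C Q T \<and> (\<forall>k \<in> I. h \<cdot>\<^bsub>C\<^esub> \<iota> k = \<tau> k)))"

definition has_finite_coproducts :: "('o, 'a) cat \<Rightarrow> bool" where
  "has_finite_coproducts C \<longleftrightarrow>
     (\<forall>(n :: nat) X. (\<forall>k < n. X k \<in> Obj C) \<longrightarrow> (\<exists>Q \<iota>. is_coproduct C {..<n} X Q \<iota>))"

text \<open>\<open>binary_coproduct C A B i j\<close>: the arrows \<open>i : A \<rightarrow> Q\<close> and \<open>j : B \<rightarrow> Q\<close> are the injections of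
  a coproduct \<open>Q = A + B\<close>.\<close>

definition binary_coproduct :: "('o, 'a) cat \<Rightarrow> 'o \<Rightarrow> 'o \<Rightarrow> 'a \<Rightarrow> 'a \<Rightarrow> bool" where
  "binary_coproduct C A B i j \<longleftrightarrow> (\<exists>Q. i \<in> hom C A Q \<and> j \<in> hom C B Q \<and>
     (\<forall>T. \<forall>u \<in> hom C A T. \<forall>v \<in> hom C B T.
        \<exists>!h. h \<in> hom C Q T \<and> h \<cdot>\<^bsub>C\<^esub> i = u \<and> h \<cdot>\<^bsub>C\<^esub> j = v))"

text \<open>\<open>copair C i j u v\<close> is \<open>[u, v]\<close>, and \<open>arrow_sum C i j i' j' f g\<close> is \<open>f + g\<close>, with respect to the
  coproduct injections \<open>i, j\<close> of the domain (and \<open>i', j'\<close> of the codomain).\<close>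

definition copair :: "('o, 'a) cat \<Rightarrow> 'a \<Rightarrow> 'a \<Rightarrow> 'a \<Rightarrow> 'a \<Rightarrow> 'a" where
  "copair C i j u v =
     (THE h. h \<in> hom C (Cod C i) (Cod C u) \<and> h \<cdot>\<^bsub>C\<^esub> i = u \<and> h \<cdot>\<^bsub>C\<^esub> j = v)"

definition arrow_sum ::
  "('o, 'a) cat \<Rightarrow> 'a \<Rightarrow> 'a \<Rightarrow> 'a \<Rightarrow> 'a \<Rightarrow> 'a \<Rightarrow> 'a \<Rightarrow> 'a" where
  "arrow_sum C i j i' j' f g = copair C i j (i' \<cdot>\<^bsub>C\<^esub> f) (j' \<cdot>\<^bsub>C\<^esub> g)"


section \<open>Squares, pullbacks and pushouts\<close>

text \<open>The four arrows of a square are always listed in the order top, left, right, bottom: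
  \<open>t : P \<rightarrow> A\<close>, \<open>l : P \<rightarrow> B\<close>, \<open>r : A \<rightarrow> X\<close>, \<open>b : B \<rightarrow> X\<close>.\<close>

definition comm_square :: "('o, 'a) cat \<Rightarrow> 'a \<Rightarrow> 'a \<Rightarrow> 'a \<Rightarrow> 'a \<Rightarrow> bool" where
  "comm_square C t l r b \<longleftrightarrow> (\<exists>P A B X. t \<in> hom C P A \<and> l \<in> hom C P B \<and>
     r \<in> hom C A X \<and> b \<in> hom C B X \<and> r \<cdot>\<^bsub>C\<^esub> t = b \<cdot>\<^bsub>C\<^esub> l)"

definition is_pullback :: "('o, 'a) cat \<Rightarrow> 'a \<Rightarrow> 'a \<Rightarrow> 'a \<Rightarrow> 'a \<Rightarrow> bool" where
  "is_pullback C t l r b \<longleftrightarrow> comm_square C t l r b \<and>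
     (\<forall>u v. comm_square C u v r b \<longrightarrow>
        (\<exists>!h. h \<in> hom C (Dom C u) (Dom C t) \<and> t \<cdot>\<^bsub>C\<^esub> h = u \<and> l \<cdot>\<^bsub>C\<^esub> h = v))"

definition is_pushout :: "('o, 'a) cat \<Rightarrow> 'a \<Rightarrow> 'a \<Rightarrow> 'a \<Rightarrow> 'a \<Rightarrow> bool" where
  "is_pushout C t l r b \<longleftrightarrow> comm_square C t l r b \<and>
     (\<forall>u v. comm_square C t l u v \<longrightarrow>
        (\<exists>!h. h \<in> hom C (Cod C r) (Cod C u) \<and> h \<cdot>\<^bsub>C\<^esub> r = u \<and> h \<cdot>\<^bsub>C\<^esub> b = v))"

definition kernel_pair :: "('o, 'a) cat \<Rightarrow> 'a \<Rightarrow> 'a \<Rightarrow> 'a \<Rightarrow> bool" where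
  "kernel_pair C f p q \<longleftrightarrow> is_pullback C p q f f"


section \<open>Monomorphisms and regular epimorphisms\<close>

definition is_mono :: "('o, 'a) cat \<Rightarrow> 'a \<Rightarrow> bool" where
  "is_mono C m \<longleftrightarrow> m \<in> Arr C \<and>
     (\<forall>T. \<forall>x \<in> hom C T (Dom C m). \<forall>y \<in> hom C T (Dom C m).
        m \<cdot>\<^bsub>C\<^esub> x = m \<cdot>\<^bsub>C\<^esub> y \<longrightarrow> x = y)"

definition is_coequalizer :: "('o, 'a) cat \<Rightarrow> 'a \<Rightarrow> 'a \<Rightarrow> 'a \<Rightarrow> bool" where
  "is_coequalizer C f g p \<longleftrightarrow> (\<exists>R E B. f \<in> hom C R E \<and> g \<in> hom C R E \<and> p \<in> hom C E B \<and>
     p \<cdot>\<^bsub>C\<^esub> f = p \<cdot>\<^bsub>C\<^esub> g \<and>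
     (\<forall>T. \<forall>u \<in> hom C E T. u \<cdot>\<^bsub>C\<^esub> f = u \<cdot>\<^bsub>C\<^esub> g \<longrightarrow>
        (\<exists>!h. h \<in> hom C B T \<and> h \<cdot>\<^bsub>C\<^esub> p = u)))"

definition regular_epi :: "('o, 'a) cat \<Rightarrow> 'a \<Rightarrow> bool" where
  "regular_epi C p \<longleftrightarrow> (\<exists>f g. is_coequalizer C f g p)"

text \<open>In the presence of pullbacks it is immaterial which pullback is used to test feebleness,
  since regular epimorphisms are stable under composition with isomorphisms.\<close>

definition feeble_pullback :: "('o, 'a) cat \<Rightarrow> 'a \<Rightarrow> 'a \<Rightarrow> 'a \<Rightarrow> 'a \<Rightarrow> bool" where
  "feeble_pullback C t l r b \<longleftrightarrow> comm_square C t l r b \<and>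
     (\<exists>p q h. is_pullback C p q r b \<and> h \<in> hom C (Dom C t) (Dom C p) \<and>
        p \<cdot>\<^bsub>C\<^esub> h = t \<and> q \<cdot>\<^bsub>C\<^esub> h = l \<and> regular_epi C h)"


section \<open>Regular and exact categories\<close>

definition regular_category :: "('o, 'a) cat \<Rightarrow> bool" where
  "regular_category C \<longleftrightarrow> category C \<and> finitely_complete C \<and>
     (\<forall>f p q. kernel_pair C f p q \<longrightarrow> (\<exists>e. is_coequalizer C p q e)) \<and>
     (\<forall>t l r b. is_pullback C t l r b \<and> regular_epi C r \<longrightarrow> regular_epi C l)"

text \<open>An internal relation on \<open>A\<close> is a jointly monic pair \<open>r\<^sub>1, r\<^sub>2 : R \<rightarrow> A\<close>, that is, a
  subobject of \<open>A \<times> A\<close>. Transitivity is tested on the object of composable pairs, the pullback of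
  \<open>r\<^sub>2\<close> and \<open>r\<^sub>1\<close>.\<close>

definition internal_relation :: "('o, 'a) cat \<Rightarrow> 'o \<Rightarrow> 'a \<Rightarrow> 'a \<Rightarrow> bool" where
  "internal_relation C A r\<^sub>1 r\<^sub>2 \<longleftrightarrow> (\<exists>R. r\<^sub>1 \<in> hom C R A \<and> r\<^sub>2 \<in> hom C R A \<and>
     (\<forall>T. \<forall>x \<in> hom C T R. \<forall>y \<in> hom C T R.
        r\<^sub>1 \<cdot>\<^bsub>C\<^esub> x = r\<^sub>1 \<cdot>\<^bsub>C\<^esub> y \<and> r\<^sub>2 \<cdot>\<^bsub>C\<^esub> x = r\<^sub>2 \<cdot>\<^bsub>C\<^esub> y \<longrightarrow> x = y))"

definition internal_equivalence :: "('o, 'a) cat \<Rightarrow> 'o \<Rightarrow> 'a \<Rightarrow> 'a \<Rightarrow> bool" where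
  "internal_equivalence C A r\<^sub>1 r\<^sub>2 \<longleftrightarrow> internal_relation C A r\<^sub>1 r\<^sub>2 \<and>
     (\<exists>s \<in> hom C A (Dom C r\<^sub>1). r\<^sub>1 \<cdot>\<^bsub>C\<^esub> s = Id C A \<and> r\<^sub>2 \<cdot>\<^bsub>C\<^esub> s = Id C A) \<and>
     (\<exists>s \<in> hom C (Dom C r\<^sub>1) (Dom C r\<^sub>1). r\<^sub>1 \<cdot>\<^bsub>C\<^esub> s = r\<^sub>2 \<and> r\<^sub>2 \<cdot>\<^bsub>C\<^esub> s = r\<^sub>1) \<and>
     (\<forall>p q. is_pullback C p q r\<^sub>2 r\<^sub>1 \<longrightarrow>
        (\<exists>s \<in> hom C (Dom C p) (Dom C r\<^sub>1).
           r\<^sub>1 \<cdot>\<^bsub>C\<^esub> s = r\<^sub>1 \<cdot>\<^bsub>C\<^esub> p \<and> r\<^sub>2 \<cdot>\<^bsub>C\<^esub> s = r\<^sub>2 \<cdot>\<^bsub>C\<^esub> q))"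

definition exact_category :: "('o, 'a) cat \<Rightarrow> bool" where
  "exact_category C \<longleftrightarrow> regular_category C \<and>
     (\<forall>A r\<^sub>1 r\<^sub>2. internal_equivalence C A r\<^sub>1 r\<^sub>2 \<longrightarrow> (\<exists>f. kernel_pair C f r\<^sub>1 r\<^sub>2))"


section \<open>Condition P\<close>

text \<open>No coproducts are chosen; each clause is required for all coproducts of the objects
  involved, which by uniqueness of coproducts up to isomorphism is the same as requiring it for
  some choice.\<close>

definition coproducts_preserve_pullbacks :: "('o, 'a) cat \<Rightarrow> bool" where
  "coproducts_preserve_pullbacks C \<longleftrightarrow>
     (\<forall>t l r b t' l' r' b' iP jP iA jA iB jB iX jX.
        is_pullback C t l r b \<and> is_pullback C t' l' r' b' \<and>
        binary_coproduct C (Dom C t) (Dom C t') iP jP \<and>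
        binary_coproduct C (Cod C t) (Cod C t') iA jA \<and>
        binary_coproduct C (Cod C l) (Cod C l') iB jB \<and>
        binary_coproduct C (Cod C r) (Cod C r') iX jX \<longrightarrow>
        is_pullback C
          (arrow_sum C iP jP iA jA t t') (arrow_sum C iP jP iB jB l l')
          (arrow_sum C iA jA iX jX r r') (arrow_sum C iB jB iX jX b b'))"

definition mono_square_pullback :: "('o, 'a) cat \<Rightarrow> bool" where
  "mono_square_pullback C \<longleftrightarrow>
     (\<forall>S A m i j i' j'.
        m \<in> hom C S A \<and> is_mono C m \<and>
        binary_coproduct C S S i j \<and> binary_coproduct C A S i' j' \<longrightarrow>
        is_pullback C
          (arrow_sum C i j i' j' m (Id C S)) (copair C i j (Id C S) (Id C S))
          (copair C i' j' (Id C A) m) m)"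

definition regular_epi_square_feeble :: "('o, 'a) cat \<Rightarrow> bool" where
  "regular_epi_square_feeble C \<longleftrightarrow>
     (\<forall>E B p i j i' j'.
        p \<in> hom C E B \<and> regular_epi C p \<and>
        binary_coproduct C E E i j \<and> binary_coproduct C B B i' j' \<longrightarrow>
        feeble_pullback C
          (arrow_sum C i j i' j' p p) (copair C i j (Id C E) (Id C E))
          (copair C i' j' (Id C B) (Id C B)) p)"

definition condition_P :: "('o, 'a) cat \<Rightarrow> bool" where
  "condition_P C \<longleftrightarrow> category C \<and> finitely_complete C \<and>
     has_finite_coproducts C \<and> coproducts_preserve_pullbacks C \<and>
     mono_square_pullback C \<and> regular_epi_square_feeble C"

end

theory Submission
  imports Defs
begin

text \<open>The pushout of a monomorphism \<open>m : S \<rightarrow> A\<close> and \<open>f : S \<rightarrow> B\<close> is the coequaliser of the reflexive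
  graph \<open>d, c : A + S + B \<rightarrow> A + B\<close> given on elements by \<open>d (a, s, b) = (a + m s, b)\<close> and
  \<open>c (a, s, b) = (a, f s + b)\<close>. Coproducts of pullbacks being pullbacks, the image \<open>R\<close> of \<open>(d, c)\<close> is
  transitive; by (c) and (d) the kernel pair of \<open>d\<close> is covered by \<open>A + S + S + S + B\<close>, whence \<open>R\<close> is
  confluent, \<open>R R\<^sup>\<circ> \<le> R\<^sup>\<circ> R\<close>. So \<open>R\<^sup>\<circ> R\<close> is an equivalence relation and, by exactness, the kernel
  pair of its coequaliser. The subobject \<open>S + B\<close> of \<open>A + B\<close> is saturated for it, again by (c), and on
  it \<open>[f, 1] : S + B \<rightarrow> B\<close> is invariant. This yields both the monicity of \<open>B \<rightarrow> Q\<close> and the pullback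
  property.\<close>

section \<open>Categories\<close>

text \<open>A regular category is only known to have coequalizers of kernel pairs, so the graph must
  be replaced by an effective equivalence relation with the same quotient. In general that takes
  zigzags of unbounded length. Here a step of the graph rewrites \<open>m s\<close> on the
  \<open>A\<close> side to \<open>f s\<close> on the \<open>B\<close> side. Transitivity merges
  consecutive steps, and confluence turns a peak (two steps out of one element) into a valley (two
  steps into one element), so every zigzag collapses to a single valley. The obstacle is confluence:
  two decompositions a + m s = a' + m s' need a common refinement, and (d) grants one only after
  passing to a regular epimorphism. Hence witnesses are always sought locally, on a cover of the
  domain. They descend to actual arrows when the target is a monomorphism or a jointly monic pair,
  and equations descend because regular epimorphisms are epic. The tuples are formal: entries stand
  for the components of a copairing and + for a codiagonal. A map out of a coproduct is fixed by its
  components, so an identity read off tuples is an identity of copairings.\<close>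

context category
begin

section \<open>Composition and the universal property of pullbacks\<close>

lemma comp_arr [simp]:
  assumes "f \<in> Arr C" "g \<in> Arr C" "Cod C f = Dom C g"
  shows "g \<cdot> f \<in> Arr C" "Dom C (g \<cdot> f) = Dom C f" "Cod C (g \<cdot> f) = Cod C g"
  using comp_hom[of f "Dom C f" "Dom C g" g "Cod C g"] assms by (auto simp: hom_def)

lemma id_arr [simp]:
  assumes "A \<in> Obj C"
  shows "Id C A \<in> Arr C" "Dom C (Id C A) = A" "Cod C (Id C A) = A"
  using id_hom[OF assms] by (auto simp: hom_def)

lemma id_right [simp]: "\<lbrakk>f \<in> Arr C; Dom C f = A\<rbrakk> \<Longrightarrow> f \<cdot> Id C A = f"
  using comp_id_right[of f A "Cod C f"] by (auto simp: hom_def)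

lemma id_left [simp]: "\<lbrakk>f \<in> Arr C; Cod C f = A\<rbrakk> \<Longrightarrow> Id C A \<cdot> f = f"
  using comp_id_left[of f "Dom C f" A] by (auto simp: hom_def)

lemma assoc [simp]:
  "\<lbrakk>f \<in> Arr C; g \<in> Arr C; h \<in> Arr C; Cod C f = Dom C g; Cod C g = Dom C h\<rbrakk>
    \<Longrightarrow> (h \<cdot> g) \<cdot> f = h \<cdot> (g \<cdot> f)"
  using comp_assoc[of f "Dom C f" "Cod C f" g "Cod C g" h "Cod C h"] by (auto simp: hom_def)

lemma arr_obj [simp]: "f \<in> Arr C \<Longrightarrow> Dom C f \<in> Obj C" "f \<in> Arr C \<Longrightarrow> Cod C f \<in> Obj C"
  by (simp_all add: dom_obj cod_obj)

text \<open>Composites are normalised to the right, which hides the factor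
  \<open>g \<cdot> f\<close> inside a longer composite. This evaluates an equation of arrows at a
  generalised element \<open>x\<close> in that normal form.\<close>

lemma comp_eq_comp:
  assumes "g \<cdot> f = k \<cdot> l" "f \<in> Arr C" "g \<in> Arr C" "k \<in> Arr C" "l \<in> Arr C" "x \<in> Arr C"
    "Cod C f = Dom C g" "Cod C l = Dom C k" "Cod C x = Dom C f"
  shows "g \<cdot> (f \<cdot> x) = k \<cdot> (l \<cdot> x)"
proof -
  have "Dom C l = Dom C f" using assms comp_arr(2) by metis
  have "(g \<cdot> f) \<cdot> x = (k \<cdot> l) \<cdot> x" using assms(1) by simp
  thus ?thesis using assms(2-) \<open>Dom C l = Dom C f\<close> by simp
qed

lemma comp_eq_arr:
  assumes "g \<cdot> f = k" "f \<in> Arr C" "g \<in> Arr C" "x \<in> Arr C" "Cod C f = Dom C g" "Cod C x = Dom C f"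
  shows "g \<cdot> (f \<cdot> x) = k \<cdot> x"
  using assms by auto

lemma comm_square_iff:
  "comm_square C t l r b \<longleftrightarrow> t \<in> Arr C \<and> l \<in> Arr C \<and> r \<in> Arr C \<and> b \<in> Arr C \<and>
     Dom C t = Dom C l \<and> Cod C t = Dom C r \<and> Cod C l = Dom C b \<and> Cod C r = Cod C b \<and>
     r \<cdot> t = b \<cdot> l"
  by (auto simp: comm_square_def hom_def)

lemma pullbackD:
  assumes "is_pullback C t l r b"
  shows "t \<in> Arr C" "l \<in> Arr C" "r \<in> Arr C" "b \<in> Arr C" "Dom C l = Dom C t" "Cod C t = Dom C r"
    "Cod C l = Dom C b" "Cod C r = Cod C b" "r \<cdot> t = b \<cdot> l"
  using assms by (auto simp: is_pullback_def comm_square_iff)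

lemma pullback_factor:
  assumes "is_pullback C t l r b" "u \<in> Arr C" "v \<in> Arr C" "Dom C u = Dom C v"
    "Cod C u = Dom C r" "Cod C v = Dom C b" "r \<cdot> u = b \<cdot> v"
  obtains h where "h \<in> Arr C" "Dom C h = Dom C u" "Cod C h = Dom C t" "t \<cdot> h = u" "l \<cdot> h = v"
proof -
  have "comm_square C u v r b" using assms pullbackD[OF assms(1)] by (simp add: comm_square_iff)
  hence "\<exists>!h. h \<in> hom C (Dom C u) (Dom C t) \<and> t \<cdot> h = u \<and> l \<cdot> h = v"
    using assms(1) unfolding is_pullback_def by blast
  thus ?thesis using that by (auto simp: hom_def)
qed

lemma pullback_cancel:
  assumes "is_pullback C t l r b" "x \<in> Arr C" "y \<in> Arr C" "Dom C x = Dom C y"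
    "Cod C x = Dom C t" "Cod C y = Dom C t" "t \<cdot> x = t \<cdot> y" "l \<cdot> x = l \<cdot> y"
  shows "x = y"
proof -
  note D[simp] = pullbackD(1-8)[OF assms(1)]
  have "r \<cdot> t \<cdot> x = b \<cdot> l \<cdot> x"
    using comp_eq_comp[OF pullbackD(9)[OF assms(1)]] assms by simp
  hence "comm_square C (t \<cdot> x) (l \<cdot> x) r b" using assms by (simp add: comm_square_iff)
  hence "\<exists>!h. h \<in> hom C (Dom C (t \<cdot> x)) (Dom C t) \<and> t \<cdot> h = t \<cdot> x \<and> l \<cdot> h = l \<cdot> x"
    using assms(1) unfolding is_pullback_def by blast
  thus ?thesis using assms by (auto simp: hom_def)
qed

lemma pullbackI:
  assumes "t \<in> Arr C" "l \<in> Arr C" "r \<in> Arr C" "b \<in> Arr C" "Dom C l = Dom C t" "Cod C t = Dom C r"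
    "Cod C l = Dom C b" "Cod C r = Cod C b" "r \<cdot> t = b \<cdot> l"
    and "\<And>u v. \<lbrakk>u \<in> Arr C; v \<in> Arr C; Dom C u = Dom C v; Cod C u = Dom C r; Cod C v = Dom C b;
      r \<cdot> u = b \<cdot> v\<rbrakk>
      \<Longrightarrow> \<exists>h. h \<in> Arr C \<and> Dom C h = Dom C u \<and> Cod C h = Dom C t \<and> t \<cdot> h = u \<and> l \<cdot> h = v"
    and "\<And>x y. \<lbrakk>x \<in> Arr C; y \<in> Arr C; Dom C x = Dom C y; Cod C x = Dom C t; Cod C y = Dom C t;
      t \<cdot> x = t \<cdot> y; l \<cdot> x = l \<cdot> y\<rbrakk> \<Longrightarrow> x = y"
  shows "is_pullback C t l r b"
  unfolding is_pullback_def
proof (intro conjI allI impI)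
  show "comm_square C t l r b" using assms(1-9) by (simp add: comm_square_iff)
  fix u v assume sq: "comm_square C u v r b"
  show "\<exists>!h. h \<in> hom C (Dom C u) (Dom C t) \<and> t \<cdot> h = u \<and> l \<cdot> h = v"
  proof (rule ex_ex1I)
    show "\<exists>h. h \<in> hom C (Dom C u) (Dom C t) \<and> t \<cdot> h = u \<and> l \<cdot> h = v"
      using assms(10)[of u v] sq by (fastforce simp: comm_square_iff hom_def)
    show "x = y" if "x \<in> hom C (Dom C u) (Dom C t) \<and> t \<cdot> x = u \<and> l \<cdot> x = v"
      "y \<in> hom C (Dom C u) (Dom C t) \<and> t \<cdot> y = u \<and> l \<cdot> y = v" for x y
      using assms(11)[of x y] that by (auto simp: hom_def)
  qed
qed

lemma pullback_sym:
  assumes pb: "is_pullback C t l r b"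
  shows "is_pullback C l t b r"
proof (rule pullbackI)
  show "\<exists>h. h \<in> Arr C \<and> Dom C h = Dom C u \<and> Cod C h = Dom C l \<and> l \<cdot> h = u \<and> t \<cdot> h = v"
    if "u \<in> Arr C" "v \<in> Arr C" "Dom C u = Dom C v" "Cod C u = Dom C b" "Cod C v = Dom C r"
      "b \<cdot> u = r \<cdot> v" for u v
    using pullback_factor[OF pb, of v u] that pullbackD(5)[OF pb] by metis
  show "x = y" if "x \<in> Arr C" "y \<in> Arr C" "Dom C x = Dom C y" "Cod C x = Dom C l"
      "Cod C y = Dom C l" "l \<cdot> x = l \<cdot> y" "t \<cdot> x = t \<cdot> y" for x y
    using pullback_cancel[OF pb, of x y] that pullbackD(5)[OF pb] by simp
qed (use pullbackD[OF pb] in simp_all)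

lemma pullback_id_horizontal:
  assumes [simp]: "f \<in> Arr C" and "A = Cod C f" "B = Dom C f"
  shows "is_pullback C f (Id C B) (Id C A) f"
  using assms(2,3) by (intro pullbackI) auto

lemma pullback_id_vertical:
  assumes [simp]: "f \<in> Arr C" and "A = Cod C f" "B = Dom C f"
  shows "is_pullback C (Id C B) f f (Id C A)"
  using assms(2,3) by (intro pullbackI) auto

section \<open>Monomorphisms, coequalizers and regular epimorphisms\<close>

lemma monoD:
  assumes "is_mono C m" "x \<in> Arr C" "y \<in> Arr C" "Dom C x = Dom C y"
    "Cod C x = Dom C m" "Cod C y = Dom C m" "m \<cdot> x = m \<cdot> y"
  shows "x = y"
  using assms unfolding is_mono_def hom_def by blast

lemma mono_arr: "is_mono C m \<Longrightarrow> m \<in> Arr C"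
  by (simp add: is_mono_def)

lemma monoI:
  assumes "m \<in> Arr C"
    and "\<And>x y. \<lbrakk>x \<in> Arr C; y \<in> Arr C; Dom C x = Dom C y; Cod C x = Dom C m; Cod C y = Dom C m;
      m \<cdot> x = m \<cdot> y\<rbrakk> \<Longrightarrow> x = y"
  shows "is_mono C m"
  using assms unfolding is_mono_def hom_def by auto

text \<open>Casting monicity as a pullback square lets (b) carry it across coproducts.\<close>

lemma mono_iff_pullback:
  assumes [simp]: "m \<in> Arr C"
  shows "is_mono C m \<longleftrightarrow> is_pullback C (Id C (Dom C m)) (Id C (Dom C m)) m m"
proof
  assume "is_mono C m"
  thus "is_pullback C (Id C (Dom C m)) (Id C (Dom C m)) m m"
    by (intro pullbackI) (use monoD[OF \<open>is_mono C m\<close>] in auto)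
next
  assume pb: "is_pullback C (Id C (Dom C m)) (Id C (Dom C m)) m m"
  show "is_mono C m"
  proof (rule monoI)
    fix x y assume a: "x \<in> Arr C" "y \<in> Arr C" "Dom C x = Dom C y" "Cod C x = Dom C m"
      "Cod C y = Dom C m" "m \<cdot> x = m \<cdot> y"
    then obtain h where "h \<in> Arr C" "Cod C h = Dom C (Id C (Dom C m))"
      "Id C (Dom C m) \<cdot> h = x" "Id C (Dom C m) \<cdot> h = y"
      using pullback_factor[OF pb, of x y] by metis
    thus "x = y" by simp
  qed simp
qed

lemma regular_epi_arr: "regular_epi C e \<Longrightarrow> e \<in> Arr C"
  by (auto simp: regular_epi_def is_coequalizer_def hom_def)

lemma coequalizerD:
  assumes "is_coequalizer C f g p"
  shows "f \<in> Arr C" "g \<in> Arr C" "p \<in> Arr C" "Dom C f = Dom C g" "Cod C f = Dom C p"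
    "Cod C g = Dom C p" "p \<cdot> f = p \<cdot> g" "regular_epi C p"
  using assms by (auto simp: is_coequalizer_def hom_def regular_epi_def)

lemma coequalizer_universal:
  assumes "is_coequalizer C f g p" "u \<in> hom C (Dom C p) T" "u \<cdot> f = u \<cdot> g"
  shows "\<exists>!h. h \<in> hom C (Cod C p) T \<and> h \<cdot> p = u"
proof -
  obtain R E B where "p \<in> hom C E B"
    and univ: "\<forall>T. \<forall>u \<in> hom C E T. u \<cdot> f = u \<cdot> g \<longrightarrow> (\<exists>!h. h \<in> hom C B T \<and> h \<cdot> p = u)"
    using assms(1) unfolding is_coequalizer_def by blast
  hence "Dom C p = E" "Cod C p = B" by (auto simp: hom_def)
  thus ?thesis using univ assms(2,3) by blast
qed

lemma coequalizer_factor: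
  assumes "is_coequalizer C f g p" "u \<in> Arr C" "Dom C u = Dom C p" "u \<cdot> f = u \<cdot> g"
  obtains h where "h \<in> Arr C" "Dom C h = Cod C p" "Cod C h = Cod C u" "h \<cdot> p = u"
proof -
  have "u \<in> hom C (Dom C p) (Cod C u)" using assms by (simp add: hom_def)
  from coequalizer_universal[OF assms(1) this assms(4)] show ?thesis
    using that by (auto simp: hom_def)
qed

lemma coequalizerI:
  assumes "f \<in> Arr C" "g \<in> Arr C" "p \<in> Arr C" "Dom C f = Dom C g" "Cod C f = Dom C p"
    "Cod C g = Dom C p" "p \<cdot> f = p \<cdot> g"
    and "\<And>u. \<lbrakk>u \<in> Arr C; Dom C u = Dom C p; u \<cdot> f = u \<cdot> g\<rbrakk>
      \<Longrightarrow> \<exists>h. h \<in> Arr C \<and> Dom C h = Cod C p \<and> Cod C h = Cod C u \<and> h \<cdot> p = u"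
    and "\<And>x y. \<lbrakk>x \<in> Arr C; y \<in> Arr C; Dom C x = Cod C p; Dom C y = Cod C p; x \<cdot> p = y \<cdot> p\<rbrakk> \<Longrightarrow> x = y"
  shows "is_coequalizer C f g p"
proof -
  have "\<exists>!h. h \<in> hom C (Cod C p) T \<and> h \<cdot> p = u" if "u \<in> hom C (Dom C p) T" "u \<cdot> f = u \<cdot> g" for T u
  proof (rule ex_ex1I)
    show "\<exists>h. h \<in> hom C (Cod C p) T \<and> h \<cdot> p = u" using assms(8)[of u] that by (auto simp: hom_def)
    show "h = k" if "h \<in> hom C (Cod C p) T \<and> h \<cdot> p = u" "k \<in> hom C (Cod C p) T \<and> k \<cdot> p = u" for h k
      using assms(9)[of h k] that by (simp add: hom_def)
  qed
  moreover have "f \<in> hom C (Dom C f) (Dom C p)" "g \<in> hom C (Dom C f) (Dom C p)"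
    "p \<in> hom C (Dom C p) (Cod C p)" using assms(1-6) by (auto simp: hom_def)
  ultimately show ?thesis unfolding is_coequalizer_def using assms(7) by blast
qed

text \<open>\<open>e\<close> coequalizes some unknown pair. An arrow that does not separate elements
  identified by \<open>e\<close> coequalizes that pair too, so it factors without any kernel pair
  being constructed.\<close>

lemma regular_epi_factor:
  assumes "regular_epi C e" "u \<in> Arr C" "Dom C u = Dom C e"
    and "\<And>x y. \<lbrakk>x \<in> Arr C; y \<in> Arr C; Dom C x = Dom C y; Cod C x = Dom C e; Cod C y = Dom C e;
      e \<cdot> x = e \<cdot> y\<rbrakk> \<Longrightarrow> u \<cdot> x = u \<cdot> y"
  obtains h where "h \<in> Arr C" "Dom C h = Cod C e" "Cod C h = Cod C u" "h \<cdot> e = u"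
proof -
  obtain f g where coeq: "is_coequalizer C f g e" using assms(1) by (auto simp: regular_epi_def)
  have "u \<cdot> f = u \<cdot> g" using assms(4) coequalizerD[OF coeq] by metis
  thus ?thesis using coequalizer_factor[OF coeq assms(2,3)] that by metis
qed

lemma regular_epi_cancel:
  assumes "regular_epi C e" "x \<in> Arr C" "y \<in> Arr C" "Dom C x = Cod C e" "Dom C y = Cod C e"
    "x \<cdot> e = y \<cdot> e"
  shows "x = y"
proof -
  obtain f g where coeq: "is_coequalizer C f g e" using assms(1) by (auto simp: regular_epi_def)
  note [simp] = coequalizerD(1-6)[OF coeq]
  have cod: "Cod C x = Cod C y" using arg_cong[OF assms(6), of "Cod C"] assms(2-5) by simp
  have "(x \<cdot> e) \<cdot> f = (x \<cdot> e) \<cdot> g" using assms coequalizerD(7)[OF coeq] by simp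
  moreover have "x \<cdot> e \<in> hom C (Dom C e) (Cod C x)" using assms(1-5) by (simp add: hom_def)
  ultimately have "\<exists>!h. h \<in> hom C (Cod C e) (Cod C x) \<and> h \<cdot> e = x \<cdot> e"
    using coequalizer_universal[OF coeq] by blast
  moreover have "x \<in> hom C (Cod C e) (Cod C x)" "y \<in> hom C (Cod C e) (Cod C x)"
    using assms(2-5) cod by (simp_all add: hom_def)
  ultimately show ?thesis using assms(6) by metis
qed

text \<open>A split epimorphism coequalizes the idempotent \<open>s \<cdot> p\<close> and the
  identity; the factorisation of \<open>u\<close> is \<open>u \<cdot> s\<close>.\<close>

lemma regular_epi_split:
  assumes "p \<in> Arr C" "s \<in> Arr C" "Dom C s = Cod C p" "Cod C s = Dom C p" "p \<cdot> s = Id C (Cod C p)"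
  shows "regular_epi C p"
proof -
  note [simp] = assms(1-4)
  have "is_coequalizer C (s \<cdot> p) (Id C (Dom C p)) p"
  proof (rule coequalizerI)
    show "p \<cdot> (s \<cdot> p) = p \<cdot> Id C (Dom C p)" using comp_eq_arr[OF assms(5), of p] by simp
    show "\<exists>h. h \<in> Arr C \<and> Dom C h = Cod C p \<and> Cod C h = Cod C u \<and> h \<cdot> p = u"
      if "u \<in> Arr C" "Dom C u = Dom C p" "u \<cdot> (s \<cdot> p) = u \<cdot> Id C (Dom C p)" for u
      using that by (intro exI[of _ "u \<cdot> s"]) simp
    show "x = y" if "x \<in> Arr C" "y \<in> Arr C" "Dom C x = Cod C p" "Dom C y = Cod C p" "x \<cdot> p = y \<cdot> p"
      for x y
    proof -
      have "x \<cdot> (p \<cdot> s) = y \<cdot> (p \<cdot> s)" by (rule comp_eq_comp[OF that(5)]) (simp_all add: that(1-4))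
      thus ?thesis using that(1-4) unfolding assms(5) by simp
    qed
  qed simp_all
  thus ?thesis by (auto simp: regular_epi_def)
qed

lemma regular_epi_id: "A \<in> Obj C \<Longrightarrow> regular_epi C (Id C A)"
  by (rule regular_epi_split[of _ "Id C A"]) simp_all

text \<open>Diagonal fill-in: \<open>m \<cdot> s\<close> factors through \<open>e\<close>, so
  \<open>s\<close> is constant on the fibres of \<open>e\<close> because \<open>m\<close> is monic.
  This is how a solution found on a cover descends.\<close>

lemma regular_epi_mono_lift:
  assumes "regular_epi C e" "is_mono C m" "a \<in> Arr C" "s \<in> Arr C" "Dom C a = Cod C e"
    "Dom C s = Dom C e" "Cod C a = Cod C m" "Cod C s = Dom C m" "m \<cdot> s = a \<cdot> e"
  obtains h where "h \<in> Arr C" "Dom C h = Dom C a" "Cod C h = Dom C m" "m \<cdot> h = a" "h \<cdot> e = s"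
proof -
  note [simp] = assms(3-8) regular_epi_arr[OF assms(1)] mono_arr[OF assms(2)]
  have "s \<cdot> x = s \<cdot> y" if [simp]: "x \<in> Arr C" "y \<in> Arr C" "Dom C x = Dom C y"
    "Cod C x = Dom C e" "Cod C y = Dom C e" and "e \<cdot> x = e \<cdot> y" for x y
  proof -
    have "m \<cdot> s \<cdot> x = m \<cdot> s \<cdot> y"
      using comp_eq_comp[OF assms(9), of x] comp_eq_comp[OF assms(9), of y] that(6)
      by simp
    thus ?thesis using monoD[OF assms(2), of "s \<cdot> x" "s \<cdot> y"] by simp
  qed
  then obtain h where h[simp]: "h \<in> Arr C" "Dom C h = Cod C e" "Cod C h = Cod C s"
    and hs: "h \<cdot> e = s"
    using regular_epi_factor[OF assms(1,4,6)] by metis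
  have "m \<cdot> h = a"
    using regular_epi_cancel[OF assms(1), of "m \<cdot> h" a] by (simp add: hs assms(9))
  thus ?thesis using that[of h] hs by simp
qed

end


section \<open>Regular categories\<close>

definition discrete_pair :: "(nat, nat) cat" where
  "discrete_pair = \<lparr>Obj = {0, 1}, Arr = {0, 1}, Dom = id, Cod = id, Id = id, Comp = (\<lambda>v u. u)\<rparr>"

text \<open>The arrows \<open>0, 1, 2\<close> are the identities, \<open>3 : 0 \<rightarrow> 2\<close> and \<open>4 : 1 \<rightarrow> 2\<close>.\<close>

definition cospan :: "(nat, nat) cat" where
  "cospan = \<lparr>Obj = {0, 1, 2}, Arr = {0, 1, 2, 3, 4},
     Dom = (\<lambda>u. if u = 3 then 0 else if u = 4 then 1 else u), Cod = min 2, Id = id,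
     Comp = (\<lambda>v u. if v \<le> 2 then u else v)\<rparr>"

lemma category_discrete_pair: "category discrete_pair"
  by unfold_locales (auto simp: discrete_pair_def hom_def)

lemma category_cospan: "category cospan"
  by unfold_locales (auto simp: cospan_def hom_def min_def split: if_splits)

locale regular_cat = category +
  assumes regular: "regular_category C"
begin

text \<open>A cone over \<open>cospan\<close> has a third leg, to the common codomain, which either
  of the other two determines. Cones are therefore the same as commutative squares on
  \<open>r\<close> and \<open>b\<close>.\<close>

lemma pullback_exists:
  assumes [simp]: "r \<in> Arr C" "b \<in> Arr C" and cod: "Cod C r = Cod C b"
  obtains t l where "is_pullback C t l r b"
proof -
  note One_nat_def [simp del]
  define F\<^sub>0 where "F\<^sub>0 i = (if i = 0 then Dom C r else if i = 1 then Dom C b else Cod C b)" for i :: nat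
  define F\<^sub>1 where "F\<^sub>1 u = (if u = 3 then r else if u = 4 then b else Id C (F\<^sub>0 u))" for u :: nat
  have "is_functor cospan C F\<^sub>0 F\<^sub>1"
    unfolding is_functor_def using category_cospan category_axioms cod
    by (auto simp: cospan_def F\<^sub>0_def F\<^sub>1_def hom_def)
  moreover have "finite (Obj cospan)" "finite (Arr cospan)" by (simp_all add: cospan_def)
  ultimately obtain L \<pi> where lim: "is_limit cospan C F\<^sub>0 F\<^sub>1 L \<pi>"
    using regular unfolding regular_category_def finitely_complete_def by blast
  hence cone: "is_cone cospan C F\<^sub>0 F\<^sub>1 L \<pi>" by (simp add: is_limit_def)
  have [simp]: "\<pi> 0 \<in> Arr C" "Dom C (\<pi> 0) = L" "Cod C (\<pi> 0) = Dom C r"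
    "\<pi> 1 \<in> Arr C" "Dom C (\<pi> 1) = L" "Cod C (\<pi> 1) = Dom C b"
    and eq: "r \<cdot> \<pi> 0 = \<pi> 2" "b \<cdot> \<pi> 1 = \<pi> 2"
    using cone by (auto simp: is_cone_def cospan_def F\<^sub>0_def F\<^sub>1_def hom_def)
  have cone_iff: "is_cone cospan C F\<^sub>0 F\<^sub>1 T \<tau> \<longleftrightarrow> T \<in> Obj C \<and> \<tau> 0 \<in> hom C T (Dom C r) \<and>
      \<tau> 1 \<in> hom C T (Dom C b) \<and> \<tau> 2 \<in> hom C T (Cod C b) \<and> r \<cdot> \<tau> 0 = \<tau> 2 \<and> b \<cdot> \<tau> 1 = \<tau> 2" for T \<tau>
    by (auto simp: is_cone_def cospan_def F\<^sub>0_def F\<^sub>1_def hom_def)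
  have univ: "\<exists>!h. h \<in> hom C (Dom C u) L \<and> \<pi> 0 \<cdot> h = u \<and> \<pi> 1 \<cdot> h = v"
    if [simp]: "u \<in> Arr C" "v \<in> Arr C" "Dom C u = Dom C v" "Cod C u = Dom C r" "Cod C v = Dom C b"
      and e: "r \<cdot> u = b \<cdot> v" for u v
  proof -
    define \<tau> where "\<tau> i = (if i = 0 then u else if i = 1 then v else b \<cdot> v)" for i :: nat
    have "is_cone cospan C F\<^sub>0 F\<^sub>1 (Dom C v) \<tau>"
      unfolding cone_iff by (auto simp: \<tau>_def hom_def e)
    hence "\<exists>!h. h \<in> hom C (Dom C v) L \<and> (\<forall>i\<in>Obj cospan. \<pi> i \<cdot> h = \<tau> i)"
      using lim by (simp add: is_limit_def)
    moreover have "h \<in> hom C (Dom C v) L \<and> (\<forall>i\<in>Obj cospan. \<pi> i \<cdot> h = \<tau> i) \<longleftrightarrow>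
        h \<in> hom C (Dom C v) L \<and> \<pi> 0 \<cdot> h = u \<and> \<pi> 1 \<cdot> h = v" for h
      using comp_eq_arr[OF eq(2), of h] by (auto simp: cospan_def \<tau>_def hom_def)
    ultimately show ?thesis by simp
  qed
  have "is_pullback C (\<pi> 0) (\<pi> 1) r b"
    unfolding is_pullback_def using univ eq cod by (auto simp: comm_square_iff)
  thus ?thesis using that by blast
qed

lemma product_exists:
  assumes [simp]: "A \<in> Obj C" "B \<in> Obj C"
  obtains P p q where "p \<in> Arr C" "q \<in> Arr C" "Dom C p = P" "Dom C q = P" "Cod C p = A" "Cod C q = B"
    "\<And>T u v. \<lbrakk>u \<in> hom C T A; v \<in> hom C T B\<rbrakk> \<Longrightarrow> \<exists>!h. h \<in> hom C T P \<and> p \<cdot> h = u \<and> q \<cdot> h = v"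
proof -
  note One_nat_def [simp del]
  define F\<^sub>0 where "F\<^sub>0 i = (if i = 0 then A else B)" for i :: nat
  define F\<^sub>1 where "F\<^sub>1 u = Id C (F\<^sub>0 u)" for u
  have "is_functor discrete_pair C F\<^sub>0 F\<^sub>1"
    unfolding is_functor_def using category_discrete_pair category_axioms
    by (auto simp: discrete_pair_def F\<^sub>0_def F\<^sub>1_def hom_def)
  moreover have "finite (Obj discrete_pair)" "finite (Arr discrete_pair)"
    by (simp_all add: discrete_pair_def)
  ultimately obtain L \<pi> where lim: "is_limit discrete_pair C F\<^sub>0 F\<^sub>1 L \<pi>"
    using regular unfolding regular_category_def finitely_complete_def by blast
  have cone_iff: "is_cone discrete_pair C F\<^sub>0 F\<^sub>1 T \<tau> \<longleftrightarrow>
      T \<in> Obj C \<and> \<tau> 0 \<in> hom C T A \<and> \<tau> 1 \<in> hom C T B" for T \<tau>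
    by (auto simp: is_cone_def discrete_pair_def F\<^sub>0_def F\<^sub>1_def hom_def)
  have "is_cone discrete_pair C F\<^sub>0 F\<^sub>1 L \<pi>" using lim by (simp add: is_limit_def)
  hence [simp]: "\<pi> 0 \<in> Arr C" "Dom C (\<pi> 0) = L" "Cod C (\<pi> 0) = A"
    "\<pi> 1 \<in> Arr C" "Dom C (\<pi> 1) = L" "Cod C (\<pi> 1) = B"
    by (auto simp: cone_iff hom_def)
  have "\<exists>!h. h \<in> hom C T L \<and> \<pi> 0 \<cdot> h = u \<and> \<pi> 1 \<cdot> h = v"
    if "u \<in> hom C T A" "v \<in> hom C T B" for T u v
  proof -
    have "is_cone discrete_pair C F\<^sub>0 F\<^sub>1 T (\<lambda>i. if i = 0 then u else v)"
      using that arr_obj by (auto simp: cone_iff hom_def)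
    hence "\<exists>!h. h \<in> hom C T L \<and> (\<forall>i\<in>Obj discrete_pair. \<pi> i \<cdot> h = (if i = 0 then u else v))"
      using lim by (simp add: is_limit_def)
    thus ?thesis by (simp add: discrete_pair_def)
  qed
  from that[of "\<pi> 0" "\<pi> 1" L, OF _ _ _ _ _ _ this] show ?thesis by simp
qed

text \<open>Pullback stability of regular epimorphisms, read as local surjectivity: elements of the
  codomain of \<open>e\<close> lift after passing to a cover.\<close>

lemma cover_lift:
  assumes "regular_epi C e" "x \<in> Arr C" "Cod C x = Cod C e"
  obtains t y where "regular_epi C t" "t \<in> Arr C" "y \<in> Arr C" "Cod C t = Dom C x"
    "Dom C y = Dom C t" "Cod C y = Dom C e" "e \<cdot> y = x \<cdot> t"
proof -
  obtain y t where pb: "is_pullback C y t e x"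
    using pullback_exists[of e x] assms regular_epi_arr by metis
  hence "regular_epi C t" using regular assms(1) unfolding regular_category_def by blast
  thus ?thesis using that[of t y] pullbackD[OF pb] by simp
qed

lemma kernel_pair_coequalizer:
  assumes "kernel_pair C f p q"
  obtains e where "is_coequalizer C p q e"
  using regular assms unfolding regular_category_def by blast

text \<open>The image of the pairing \<open>h\<close> of \<open>u\<close> and \<open>v\<close> into
  the product, formed as the coequalizer \<open>e\<close> of the kernel pair of \<open>h\<close>.
  For joint monicity, two elements with equal components are lifted along \<open>e\<close> over a
  common cover; the lifts agree under \<open>h\<close>, so they form an element of its kernel pair
  and \<open>e\<close> identifies them.\<close>

lemma relation_image:
  assumes [simp]: "u \<in> Arr C" "v \<in> Arr C" "Dom C u = G" "Dom C v = G" "Cod C u = X" "Cod C v = X"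
  obtains e r s where "regular_epi C e" "e \<in> Arr C" "r \<in> Arr C" "s \<in> Arr C" "Dom C e = G"
    "Dom C r = Cod C e" "Dom C s = Cod C e" "Cod C r = X" "Cod C s = X" "r \<cdot> e = u" "s \<cdot> e = v"
    "internal_relation C X r s"
proof -
  have X[simp]: "X \<in> Obj C" using arr_obj(2)[of u] by simp
  obtain P p q where [simp]: "p \<in> Arr C" "q \<in> Arr C" "Dom C p = P" "Dom C q = P" "Cod C p = X"
      "Cod C q = X"
    and univ: "\<And>T u v. \<lbrakk>u \<in> hom C T X; v \<in> hom C T X\<rbrakk>
      \<Longrightarrow> \<exists>!h. h \<in> hom C T P \<and> p \<cdot> h = u \<and> q \<cdot> h = v"
    by (rule product_exists[OF X X], rule that)
  have proj_cancel: "x = y" if "x \<in> hom C T P" "y \<in> hom C T P" "p \<cdot> x = p \<cdot> y" "q \<cdot> x = q \<cdot> y" for T x y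
  proof -
    have "p \<cdot> x \<in> hom C T X" "q \<cdot> x \<in> hom C T X" using that(1) by (auto simp: hom_def)
    from univ[OF this] that show ?thesis by metis
  qed
  obtain h where [simp]: "h \<in> Arr C" "Dom C h = G" "Cod C h = P" and h: "p \<cdot> h = u" "q \<cdot> h = v"
    using univ[of u G v] by (auto simp: hom_def)
  obtain k l where ker: "is_pullback C k l h h" using pullback_exists[of h h] by auto
  then obtain e where coeq: "is_coequalizer C k l e"
    using kernel_pair_coequalizer[of h k l] by (auto simp: kernel_pair_def)
  note [simp] = pullbackD(1,2,5-7)[OF ker]
  have e[simp]: "e \<in> Arr C" "Dom C e = G" using coequalizerD[OF coeq] by simp_all
  have e_epi: "regular_epi C e" using coequalizerD[OF coeq] by simp
  have "u \<cdot> k = u \<cdot> l" "v \<cdot> k = v \<cdot> l"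
    using comp_eq_arr[OF h(1), of k] comp_eq_arr[OF h(2), of k] comp_eq_arr[OF h(1), of l]
      comp_eq_arr[OF h(2), of l] pullbackD(9)[OF ker] by simp_all
  then obtain r s where [simp]: "r \<in> Arr C" "Dom C r = Cod C e" "Cod C r = X" "s \<in> Arr C"
      "Dom C s = Cod C e" "Cod C s = X" and rs: "r \<cdot> e = u" "s \<cdot> e = v"
    using coequalizer_factor[OF coeq, of u] coequalizer_factor[OF coeq, of v] by (metis assms e(2))
  have "x = y" if "x \<in> Arr C" "y \<in> Arr C" "Dom C x = T" "Dom C y = T" "Cod C x = Cod C e"
    "Cod C y = Cod C e" and xy: "r \<cdot> x = r \<cdot> y" "s \<cdot> x = s \<cdot> y" for x y T
  proof -
    note [simp] = that(1-6)
    obtain t x' where t: "regular_epi C t" and [simp]: "t \<in> Arr C" "x' \<in> Arr C" "Cod C t = T"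
        "Dom C x' = Dom C t" "Cod C x' = G" and x': "e \<cdot> x' = x \<cdot> t"
      using cover_lift[OF e_epi, of x] by auto
    obtain t' y' where t': "regular_epi C t'" and [simp]: "t' \<in> Arr C" "y' \<in> Arr C"
        "Cod C t' = Dom C t" "Dom C y' = Dom C t'" "Cod C y' = G" and y': "e \<cdot> y' = (y \<cdot> t) \<cdot> t'"
      using cover_lift[OF e_epi, of "y \<cdot> t"] by auto
    have "u \<cdot> (x' \<cdot> t') = u \<cdot> y'" "v \<cdot> (x' \<cdot> t') = v \<cdot> y'"
      using comp_eq_arr[OF rs(1), of "x' \<cdot> t'"] comp_eq_arr[OF rs(2), of "x' \<cdot> t'"]
        comp_eq_arr[OF rs(1), of y'] comp_eq_arr[OF rs(2), of y'] y' comp_eq_comp[OF x', of t']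
        comp_eq_comp[OF xy(1), of "t \<cdot> t'"] comp_eq_comp[OF xy(2), of "t \<cdot> t'"] by simp_all
    hence "h \<cdot> (x' \<cdot> t') = h \<cdot> y'"
      using proj_cancel[of "h \<cdot> (x' \<cdot> t')" "Dom C t'" "h \<cdot> y'"]
        comp_eq_arr[OF h(1), of "x' \<cdot> t'"] comp_eq_arr[OF h(2), of "x' \<cdot> t'"]
        comp_eq_arr[OF h(1), of y'] comp_eq_arr[OF h(2), of y']
      by (simp add: hom_def)
    then obtain z where [simp]: "z \<in> Arr C" "Cod C z = Dom C k" and z: "k \<cdot> z = x' \<cdot> t'" "l \<cdot> z = y'"
      using pullback_factor[OF ker, of "x' \<cdot> t'" y'] by auto
    have "(x \<cdot> t) \<cdot> t' = (y \<cdot> t) \<cdot> t'"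
      using comp_eq_comp[OF coequalizerD(7)[OF coeq], of z] z y' comp_eq_comp[OF x', of t'] by simp
    hence "x \<cdot> t = y \<cdot> t" using regular_epi_cancel[OF t', of "x \<cdot> t" "y \<cdot> t"] by simp
    thus "x = y" using regular_epi_cancel[OF t, of x y] by simp
  qed
  hence "internal_relation C X r s" by (auto simp: internal_relation_def hom_def)
  thus ?thesis using that[of e r s] e_epi rs by simp
qed

text \<open>The composite coequalizes its own kernel pair: a coequalizing \<open>u\<close> factors
  through \<open>e'\<close>, and the factor is constant on the fibres of \<open>e\<close> because
  elements lift locally along \<open>e'\<close>. Pullback stability is what makes this lifting
  possible.\<close>

lemma regular_epi_comp:
  assumes e: "regular_epi C e" and e': "regular_epi C e'" and cod: "Cod C e' = Dom C e"
  shows "regular_epi C (e \<cdot> e')"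
proof -
  note [simp] = regular_epi_arr[OF e] regular_epi_arr[OF e'] cod
  obtain k l where ker: "is_pullback C k l (e \<cdot> e') (e \<cdot> e')"
    using pullback_exists[of "e \<cdot> e'" "e \<cdot> e'"] by auto
  note [simp] = pullbackD(1,2,5-7)[OF ker]
  have "is_coequalizer C k l (e \<cdot> e')"
  proof (rule coequalizerI)
    show "(e \<cdot> e') \<cdot> k = (e \<cdot> e') \<cdot> l" using pullbackD(9)[OF ker] .
    fix u assume [simp]: "u \<in> Arr C" "Dom C u = Dom C (e \<cdot> e')" and u: "u \<cdot> k = u \<cdot> l"
    have u_cong: "u \<cdot> x = u \<cdot> y" if [simp]: "x \<in> Arr C" "y \<in> Arr C" "Dom C x = Dom C y"
      "Cod C x = Dom C e'" "Cod C y = Dom C e'" and xy: "e \<cdot> e' \<cdot> x = e \<cdot> e' \<cdot> y" for x y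
    proof -
      obtain z where "z \<in> Arr C" "Cod C z = Dom C k" "k \<cdot> z = x" "l \<cdot> z = y"
        using pullback_factor[OF ker, of x y] xy by auto
      thus ?thesis using comp_eq_comp[OF u, of z] by simp
    qed
    have "u \<cdot> x = u \<cdot> y" if "x \<in> Arr C" "y \<in> Arr C" "Dom C x = Dom C y" "Cod C x = Dom C e'"
      "Cod C y = Dom C e'" "e' \<cdot> x = e' \<cdot> y" for x y
      using u_cong[of x y] that by simp
    moreover have "u \<in> Arr C" "Dom C u = Dom C e'" by simp_all
    ultimately obtain h where h_arr[simp]: "h \<in> Arr C" "Dom C h = Dom C e" "Cod C h = Cod C u"
      and h: "h \<cdot> e' = u"
      using regular_epi_factor[OF e', of u] cod by metis
    have "h \<cdot> x = h \<cdot> y" if "x \<in> Arr C" "y \<in> Arr C" "Dom C x = Dom C y" "Cod C x = Dom C e"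
      "Cod C y = Dom C e" and xy: "e \<cdot> x = e \<cdot> y" for x y
    proof -
      note [simp] = that(1-5)
      obtain t x' where t: "regular_epi C t" and [simp]: "t \<in> Arr C" "x' \<in> Arr C"
          "Cod C t = Dom C y" "Dom C x' = Dom C t" "Cod C x' = Dom C e'" and x': "e' \<cdot> x' = x \<cdot> t"
        using cover_lift[OF e', of x] by auto
      obtain t' y' where t': "regular_epi C t'" and [simp]: "t' \<in> Arr C" "y' \<in> Arr C"
          "Cod C t' = Dom C t" "Dom C y' = Dom C t'" "Cod C y' = Dom C e'"
        and y': "e' \<cdot> y' = (y \<cdot> t) \<cdot> t'"
        using cover_lift[OF e', of "y \<cdot> t"] by auto
      have "u \<cdot> (x' \<cdot> t') = u \<cdot> y'"
        using u_cong[of "x' \<cdot> t'" y'] comp_eq_comp[OF x', of t'] y' comp_eq_comp[OF xy, of "t \<cdot> t'"]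
        by simp
      hence "(h \<cdot> x) \<cdot> t \<cdot> t' = (h \<cdot> y) \<cdot> t \<cdot> t'"
        using comp_eq_arr[OF h, of "x' \<cdot> t'"] comp_eq_arr[OF h, of y'] y' comp_eq_comp[OF x', of t']
        by simp
      hence "(h \<cdot> x) \<cdot> t = (h \<cdot> y) \<cdot> t"
        using regular_epi_cancel[OF t', of "(h \<cdot> x) \<cdot> t" "(h \<cdot> y) \<cdot> t"] by simp
      thus ?thesis using regular_epi_cancel[OF t, of "h \<cdot> x" "h \<cdot> y"] by simp
    qed
    then obtain g where "g \<in> Arr C" "Dom C g = Cod C e" "Cod C g = Cod C u" "g \<cdot> e = h"
      using regular_epi_factor[OF e h_arr(1,2)] h_arr(3) by metis
    thus "\<exists>h. h \<in> Arr C \<and> Dom C h = Cod C (e \<cdot> e') \<and> Cod C h = Cod C u \<and> h \<cdot> (e \<cdot> e') = u"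
      using comp_eq_arr[of g e h e'] h by (intro exI[of _ g]) auto
  next
    fix x y assume [simp]: "x \<in> Arr C" "y \<in> Arr C" "Dom C x = Cod C (e \<cdot> e')"
      "Dom C y = Cod C (e \<cdot> e')" and "x \<cdot> (e \<cdot> e') = y \<cdot> (e \<cdot> e')"
    hence "x \<cdot> e = y \<cdot> e" using regular_epi_cancel[OF e', of "x \<cdot> e" "y \<cdot> e"] by simp
    thus "x = y" using regular_epi_cancel[OF e, of x y] by simp
  qed auto
  thus ?thesis by (auto simp: regular_epi_def)
qed

end


section \<open>Condition P\<close>

locale condition_P_cat = regular_cat +
  assumes condition_P: "condition_P C"
begin

section \<open>Existence and universal property of coproducts\<close>

lemma binary_coproduct_exists:
  assumes [simp]: "A \<in> Obj C" "B \<in> Obj C"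
  shows "\<exists>i j. binary_coproduct C A B i j"
proof -
  define X where "X k = (if k = 0 then A else B)" for k :: nat
  have "\<forall>k<2. X k \<in> Obj C" by (simp add: X_def)
  then obtain Q \<iota> where cop: "is_coproduct C {..<2::nat} X Q \<iota>"
    using condition_P unfolding condition_P_def has_finite_coproducts_def by metis
  have "\<forall>k\<in>{..<2}. \<iota> k \<in> hom C (X k) Q" using cop by (simp add: is_coproduct_def)
  from bspec[OF this, of 0] bspec[OF this, of 1]
  have inj: "\<iota> 0 \<in> hom C A Q" "\<iota> 1 \<in> hom C B Q" by (simp_all add: X_def)
  have "\<exists>!h. h \<in> hom C Q T \<and> h \<cdot> \<iota> 0 = u \<and> h \<cdot> \<iota> 1 = v"
    if uv: "u \<in> hom C A T" "v \<in> hom C B T" for T u v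
  proof -
    define \<tau> where "\<tau> k = (if k = 0 then u else v)" for k :: nat
    have T: "T \<in> Obj C" using uv arr_obj by (auto simp: hom_def)
    have \<tau>: "\<forall>k\<in>{..<2}. \<tau> k \<in> hom C (X k) T" using uv by (auto simp: \<tau>_def X_def)
    have "\<exists>!h. h \<in> hom C Q T \<and> (\<forall>k\<in>{..<2}. h \<cdot> \<iota> k = \<tau> k)"
      using cop T \<tau> unfolding is_coproduct_def by blast
    moreover have "(\<forall>k\<in>{..<2}. h \<cdot> \<iota> k = \<tau> k) \<longleftrightarrow> h \<cdot> \<iota> 0 = u \<and> h \<cdot> \<iota> 1 = v" for h
      by (auto simp: \<tau>_def numeral_2_eq_2 less_Suc_eq)
    ultimately show ?thesis by simp
  qed
  with inj show ?thesis unfolding binary_coproduct_def by blast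
qed

lemma initial_exists:
  obtains Z where "Z \<in> Obj C" "\<And>T. T \<in> Obj C \<Longrightarrow> \<exists>!h. h \<in> hom C Z T"
proof -
  obtain Q \<iota> where "is_coproduct C {..<0::nat} (\<lambda>_. undefined) Q \<iota>"
    using condition_P unfolding condition_P_def has_finite_coproducts_def by blast
  thus ?thesis using that[of Q] by (auto simp: is_coproduct_def)
qed

lemma binary_coproduct_injections:
  assumes "binary_coproduct C A B i j"
  shows "i \<in> Arr C" "j \<in> Arr C" "Dom C i = A" "Dom C j = B" "Cod C j = Cod C i"
  using assms by (auto simp: binary_coproduct_def hom_def)

lemma binary_coproduct_universal:
  assumes "binary_coproduct C A B i j" "u \<in> hom C A T" "v \<in> hom C B T"
  shows "\<exists>!h. h \<in> hom C (Cod C i) T \<and> h \<cdot> i = u \<and> h \<cdot> j = v"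
proof -
  obtain Q where "i \<in> hom C A Q" and
    "\<forall>T. \<forall>u \<in> hom C A T. \<forall>v \<in> hom C B T. \<exists>!h. h \<in> hom C Q T \<and> h \<cdot> i = u \<and> h \<cdot> j = v"
    using assms(1) unfolding binary_coproduct_def by blast
  moreover from this(1) have "Cod C i = Q" by (simp add: hom_def)
  ultimately show ?thesis using assms(2,3) by blast
qed

lemma binary_coproduct_copair:
  assumes "binary_coproduct C A B i j" "u \<in> Arr C" "v \<in> Arr C" "Dom C u = A" "Dom C v = B"
    "Cod C v = Cod C u"
  shows "copair C i j u v \<in> Arr C" "Dom C (copair C i j u v) = Cod C i"
    "Cod C (copair C i j u v) = Cod C u" "copair C i j u v \<cdot> i = u" "copair C i j u v \<cdot> j = v"
proof -
  have "u \<in> hom C A (Cod C u)" "v \<in> hom C B (Cod C u)" using assms by (auto simp: hom_def)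
  from theI'[OF binary_coproduct_universal[OF assms(1) this]]
  show "copair C i j u v \<in> Arr C" "Dom C (copair C i j u v) = Cod C i"
    "Cod C (copair C i j u v) = Cod C u" "copair C i j u v \<cdot> i = u" "copair C i j u v \<cdot> j = v"
    by (auto simp: copair_def hom_def)
qed

lemma binary_coproduct_cancel:
  assumes "binary_coproduct C A B i j" "x \<in> Arr C" "y \<in> Arr C" "Dom C x = Cod C i"
    "Dom C y = Cod C i" "x \<cdot> i = y \<cdot> i" "x \<cdot> j = y \<cdot> j"
  shows "x = y"
proof -
  note [simp] = binary_coproduct_injections[OF assms(1)]
  have "Cod C x = Cod C y" using arg_cong[OF assms(6), of "Cod C"] assms(2-5) by simp
  moreover have "x \<cdot> i \<in> hom C A (Cod C x)" "x \<cdot> j \<in> hom C B (Cod C x)"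
    using assms(2-5) by (auto simp: hom_def)
  note binary_coproduct_universal[OF assms(1) this]
  ultimately have "\<lbrakk>x \<in> hom C (Cod C i) (Cod C x); y \<in> hom C (Cod C i) (Cod C x)\<rbrakk> \<Longrightarrow> x = y"
    using assms(6,7) by metis
  thus ?thesis using assms(2-5) \<open>Cod C x = Cod C y\<close> by (simp add: hom_def)
qed

section \<open>Chosen coproducts and the calculus of copairings\<close>

definition injections where
  "injections A B = (SOME ij. binary_coproduct C A B (fst ij) (snd ij))"

definition inl where "inl A B = fst (injections A B)"

definition inr where "inr A B = snd (injections A B)"

definition coprod (infixl "\<oplus>" 65) where "A \<oplus> B = Cod C (inl A B)"

definition junc (infixl "\<nabla>" 60) where
  "u \<nabla> v = copair C (inl (Dom C u) (Dom C v)) (inr (Dom C u) (Dom C v)) u v"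

definition fsum (infixl "\<boxplus>" 65) where
  "u \<boxplus> v = inl (Cod C u) (Cod C v) \<cdot> u \<nabla> inr (Cod C u) (Cod C v) \<cdot> v"

lemma binary_coproduct_inl_inr:
  assumes "A \<in> Obj C" "B \<in> Obj C"
  shows "binary_coproduct C A B (inl A B) (inr A B)"
  unfolding inl_def inr_def injections_def
  by (rule someI_ex) (use binary_coproduct_exists[OF assms] in simp)

lemma inl_inr_arr [simp]:
  assumes "A \<in> Obj C" "B \<in> Obj C"
  shows "inl A B \<in> Arr C" "inr A B \<in> Arr C" "Dom C (inl A B) = A" "Dom C (inr A B) = B"
    "Cod C (inl A B) = A \<oplus> B" "Cod C (inr A B) = A \<oplus> B" "A \<oplus> B \<in> Obj C"
  using binary_coproduct_injections[OF binary_coproduct_inl_inr[OF assms]] arr_obj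
  by (auto simp: coprod_def)

lemma junc_arr [simp]:
  assumes "u \<in> Arr C" "v \<in> Arr C" "Cod C u = Cod C v"
  shows "u \<nabla> v \<in> Arr C" "Dom C (u \<nabla> v) = Dom C u \<oplus> Dom C v" "Cod C (u \<nabla> v) = Cod C v"
  using binary_coproduct_copair[OF binary_coproduct_inl_inr[of "Dom C u" "Dom C v"], of u v] assms
  by (simp_all add: junc_def)

lemma junc_inj [simp]:
  assumes "u \<in> Arr C" "v \<in> Arr C" "Cod C u = Cod C v" "Dom C u = A" "Dom C v = B"
  shows "(u \<nabla> v) \<cdot> inl A B = u" "(u \<nabla> v) \<cdot> inr A B = v"
  using binary_coproduct_copair[OF binary_coproduct_inl_inr[of "Dom C u" "Dom C v"], of u v]
    assms(1-3) unfolding assms(4,5)[symmetric] by (simp_all add: junc_def)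

lemma junc_inj_comp [simp]:
  assumes "u \<in> Arr C" "v \<in> Arr C" "Cod C u = Cod C v" "Dom C u = A" "Dom C v = B" "x \<in> Arr C"
  shows "Cod C x = A \<Longrightarrow> (u \<nabla> v) \<cdot> (inl A B \<cdot> x) = u \<cdot> x"
    and "Cod C x = B \<Longrightarrow> (u \<nabla> v) \<cdot> (inr A B \<cdot> x) = v \<cdot> x"
proof -
  have [simp]: "A \<in> Obj C" "B \<in> Obj C" using assms arr_obj by auto
  show "Cod C x = A \<Longrightarrow> (u \<nabla> v) \<cdot> (inl A B \<cdot> x) = u \<cdot> x"
    using comp_eq_arr[OF junc_inj(1)[OF assms(1-5)], of x] assms by simp
  show "Cod C x = B \<Longrightarrow> (u \<nabla> v) \<cdot> (inr A B \<cdot> x) = v \<cdot> x"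
    using comp_eq_arr[OF junc_inj(2)[OF assms(1-5)], of x] assms by simp
qed

lemma coprod_cancel:
  assumes "x \<in> Arr C" "y \<in> Arr C" "Dom C x = A \<oplus> B" "Dom C y = A \<oplus> B" "A \<in> Obj C" "B \<in> Obj C"
    "x \<cdot> inl A B = y \<cdot> inl A B" "x \<cdot> inr A B = y \<cdot> inr A B"
  shows "x = y"
  using binary_coproduct_cancel[OF binary_coproduct_inl_inr[of A B]] assms by simp

text \<open>With the rules for injections, this makes nested copairings a normal form. Identities
  between the structural maps below are then checked by unfolding to components.\<close>

lemma comp_junc [simp]:
  assumes [simp]: "u \<in> Arr C" "v \<in> Arr C" "Cod C u = Cod C v" "h \<in> Arr C" "Cod C v = Dom C h"
  shows "h \<cdot> (u \<nabla> v) = h \<cdot> u \<nabla> h \<cdot> v"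
  by (rule coprod_cancel[of _ _ "Dom C u" "Dom C v"]) simp_all

lemma junc_inl_inr [simp]:
  "\<lbrakk>A \<in> Obj C; B \<in> Obj C\<rbrakk> \<Longrightarrow> inl A B \<nabla> inr A B = Id C (A \<oplus> B)"
  by (rule coprod_cancel[of _ _ A B]) simp_all

lemma fsum_arr [simp]:
  assumes "u \<in> Arr C" "v \<in> Arr C"
  shows "u \<boxplus> v \<in> Arr C" "Dom C (u \<boxplus> v) = Dom C u \<oplus> Dom C v" "Cod C (u \<boxplus> v) = Cod C u \<oplus> Cod C v"
  using assms by (simp_all add: fsum_def)

lemma fsum_comp:
  assumes [simp]: "u \<in> Arr C" "v \<in> Arr C" "u' \<in> Arr C" "v' \<in> Arr C"
    "Cod C u' = Dom C u" "Cod C v' = Dom C v"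
  shows "(u \<boxplus> v) \<cdot> (u' \<boxplus> v') = u \<cdot> u' \<boxplus> v \<cdot> v'"
  by (simp add: fsum_def)

lemma fsum_eq_arrow_sum:
  assumes "u \<in> Arr C" "v \<in> Arr C"
  shows "arrow_sum C (inl (Dom C u) (Dom C v)) (inr (Dom C u) (Dom C v))
    (inl (Cod C u) (Cod C v)) (inr (Cod C u) (Cod C v)) u v = u \<boxplus> v"
  using assms by (simp add: fsum_def junc_def arrow_sum_def)

section \<open>Consequences of clauses (b), (c) and (d)\<close>

lemma pullback_fsum:
  assumes "is_pullback C t l r b" "is_pullback C t' l' r' b'"
  shows "is_pullback C (t \<boxplus> t') (l \<boxplus> l') (r \<boxplus> r') (b \<boxplus> b')"
proof -
  note D = pullbackD(1-8)[OF assms(1)] and D' = pullbackD(1-8)[OF assms(2)]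
  have co: "binary_coproduct C (Dom C t) (Dom C t') (inl (Dom C t) (Dom C t')) (inr (Dom C t) (Dom C t'))"
    "binary_coproduct C (Cod C t) (Cod C t') (inl (Cod C t) (Cod C t')) (inr (Cod C t) (Cod C t'))"
    "binary_coproduct C (Cod C l) (Cod C l') (inl (Cod C l) (Cod C l')) (inr (Cod C l) (Cod C l'))"
    "binary_coproduct C (Cod C r) (Cod C r') (inl (Cod C r) (Cod C r')) (inr (Cod C r) (Cod C r'))"
    using D D' arr_obj by (auto intro!: binary_coproduct_inl_inr)
  have "coproducts_preserve_pullbacks C" using condition_P by (simp add: condition_P_def)
  from this[unfolded coproducts_preserve_pullbacks_def, rule_format, OF conjI[OF assms(1)
    conjI[OF assms(2) conjI[OF co(1) conjI[OF co(2) conjI[OF co(3) co(4)]]]]]]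
  show ?thesis
    using fsum_eq_arrow_sum[of t t'] fsum_eq_arrow_sum[of l l'] fsum_eq_arrow_sum[of r r']
      fsum_eq_arrow_sum[of b b'] D D' by simp
qed

lemma mono_fsum:
  assumes "is_mono C m" "is_mono C n"
  shows "is_mono C (m \<boxplus> n)"
proof -
  note [simp] = assms[THEN mono_arr]
  have "Id C (Dom C m) \<boxplus> Id C (Dom C n) = Id C (Dom C m \<oplus> Dom C n)" by (simp add: fsum_def)
  thus ?thesis
    using assms pullback_fsum[of "Id C (Dom C m)" "Id C (Dom C m)" m m "Id C (Dom C n)" "Id C (Dom C n)" n n]
    by (simp add: mono_iff_pullback)
qed

lemma pullback_mono_copair:
  assumes "is_mono C m" "Dom C m = S" "Cod C m = A"
  shows "is_pullback C (m \<boxplus> Id C S) (Id C S \<nabla> Id C S) (Id C A \<nabla> m) m"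
proof -
  note [simp] = mono_arr[OF assms(1)]
  have [simp]: "S \<in> Obj C" "A \<in> Obj C" using assms arr_obj by auto
  have "mono_square_pullback C" using condition_P by (simp add: condition_P_def)
  hence "is_pullback C (arrow_sum C (inl S S) (inr S S) (inl A S) (inr A S) m (Id C S))
      (copair C (inl S S) (inr S S) (Id C S) (Id C S)) (copair C (inl A S) (inr A S) (Id C A) m) m"
    unfolding mono_square_pullback_def
    by (elim allE mp) (use assms in \<open>auto simp: hom_def intro: binary_coproduct_inl_inr\<close>)
  thus ?thesis using fsum_eq_arrow_sum[of m "Id C S"] assms by (simp add: junc_def)
qed

text \<open>The coequalizer diagram of \<open>e\<close> is summed with the identity of
  \<open>B\<close>: an arrow coequalizing the sum is factored on the left summand and left alone on
  the right one.\<close>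

lemma regular_epi_fsum_id:
  assumes e: "regular_epi C e" and [simp]: "B \<in> Obj C"
  shows "regular_epi C (e \<boxplus> Id C B)"
proof -
  obtain f g where coeq: "is_coequalizer C f g e" using e by (auto simp: regular_epi_def)
  note [simp] = coequalizerD(1-6)[OF coeq] and fg = coequalizerD(7)[OF coeq]
  have "is_coequalizer C (f \<boxplus> Id C B) (g \<boxplus> Id C B) (e \<boxplus> Id C B)"
  proof (rule coequalizerI)
    show "(e \<boxplus> Id C B) \<cdot> (f \<boxplus> Id C B) = (e \<boxplus> Id C B) \<cdot> (g \<boxplus> Id C B)"
      by (simp add: fsum_def fg)
    fix u assume [simp]: "u \<in> Arr C" "Dom C u = Dom C (e \<boxplus> Id C B)"
      and eq: "u \<cdot> (f \<boxplus> Id C B) = u \<cdot> (g \<boxplus> Id C B)"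
    have "(u \<cdot> inl (Dom C e) B) \<cdot> f = (u \<cdot> inl (Dom C e) B) \<cdot> g"
      using arg_cong[OF eq, of "\<lambda>h. h \<cdot> inl (Dom C g) B"] by (simp add: fsum_def)
    then obtain k where [simp]: "k \<in> Arr C" "Dom C k = Cod C e" "Cod C k = Cod C u"
      and k: "k \<cdot> e = u \<cdot> inl (Dom C e) B"
      using coequalizer_factor[OF coeq, of "u \<cdot> inl (Dom C e) B"] by auto
    have "(k \<nabla> u \<cdot> inr (Dom C e) B) \<cdot> (e \<boxplus> Id C B) = u"
      by (rule coprod_cancel[of _ _ "Dom C e" B]) (simp_all add: fsum_def k)
    thus "\<exists>h. h \<in> Arr C \<and> Dom C h = Cod C (e \<boxplus> Id C B) \<and> Cod C h = Cod C u \<and> h \<cdot> (e \<boxplus> Id C B) = u"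
      by (intro exI[of _ "k \<nabla> u \<cdot> inr (Dom C e) B"]) simp
  next
    fix x y assume [simp]: "x \<in> Arr C" "y \<in> Arr C" "Dom C x = Cod C (e \<boxplus> Id C B)"
      "Dom C y = Cod C (e \<boxplus> Id C B)" and eq: "x \<cdot> (e \<boxplus> Id C B) = y \<cdot> (e \<boxplus> Id C B)"
    have "(x \<cdot> inl (Cod C e) B) \<cdot> e = (y \<cdot> inl (Cod C e) B) \<cdot> e"
      using arg_cong[OF eq, of "\<lambda>h. h \<cdot> inl (Dom C e) B"] by (simp add: fsum_def)
    hence l: "x \<cdot> inl (Cod C e) B = y \<cdot> inl (Cod C e) B"
      using regular_epi_cancel[OF e, of "x \<cdot> inl (Cod C e) B" "y \<cdot> inl (Cod C e) B"] by simp
    have r: "x \<cdot> inr (Cod C e) B = y \<cdot> inr (Cod C e) B"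
      using arg_cong[OF eq, of "\<lambda>h. h \<cdot> inr (Dom C e) B"] by (simp add: fsum_def)
    show "x = y" by (rule coprod_cancel[OF _ _ _ _ _ _ l r]) simp_all
  qed simp_all
  thus ?thesis by (auto simp: regular_epi_def)
qed

text \<open>For a regular epimorphism \<open>p : E \<rightarrow> A\<close>, pulling back \<open>[1, m] : A + S \<rightarrow> A\<close> along \<open>p\<close> yields,
  up to a regular epimorphism, \<open>E + (E \<times>\<^sub>A S)\<close>.\<close>

lemma cover_pullback_copair:
  assumes p: "regular_epi C p" and pb: "is_pullback C \<pi>\<^sub>E \<pi>\<^sub>S p m"
    and dom_cod: "Dom C p = E" "Cod C p = A" "Dom C m = S"
    and y: "y \<in> Arr C" "Cod C y = E" "Dom C y = T"
    and w: "w \<in> Arr C" "Cod C w = A \<oplus> S" "Dom C w = T"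
    and eq: "p \<cdot> y = (Id C A \<nabla> m) \<cdot> w"
  obtains e \<tau> where "regular_epi C e" "e \<in> Arr C" "Cod C e = T" "\<tau> \<in> Arr C"
    "Dom C \<tau> = Dom C e" "Cod C \<tau> = E \<oplus> Dom C \<pi>\<^sub>E"
    "(p \<boxplus> \<pi>\<^sub>S) \<cdot> \<tau> = w \<cdot> e" "(Id C E \<nabla> \<pi>\<^sub>E) \<cdot> \<tau> = y \<cdot> e"
proof -
  note [simp] = pullbackD(1-5)[OF pb] y w dom_cod
  have [simp]: "Cod C m = A" "Cod C \<pi>\<^sub>S = S" "Cod C \<pi>\<^sub>E = E"
    using pullbackD(6-8)[OF pb] dom_cod by simp_all
  have [simp]: "A \<in> Obj C" "E \<in> Obj C" "S \<in> Obj C"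
    using arr_obj(2)[of p] arr_obj(1)[of p] arr_obj(1)[of m] pullbackD(3,4)[OF pb] by simp_all
  have "regular_epi_square_feeble C" using condition_P by (simp add: condition_P_def)
  hence "feeble_pullback C
      (arrow_sum C (inl E E) (inr E E) (inl A A) (inr A A) p p)
      (copair C (inl E E) (inr E E) (Id C E) (Id C E))
      (copair C (inl A A) (inr A A) (Id C A) (Id C A)) p"
    unfolding regular_epi_square_feeble_def
    by (elim allE mp) (use p in \<open>auto simp: hom_def intro: binary_coproduct_inl_inr\<close>)
  hence "feeble_pullback C (p \<boxplus> p) (Id C E \<nabla> Id C E) (Id C A \<nabla> Id C A) p"
    using fsum_eq_arrow_sum[of p p] by (simp add: junc_def)
  then obtain p\<^sub>0 q\<^sub>0 h where pb\<^sub>0: "is_pullback C p\<^sub>0 q\<^sub>0 (Id C A \<nabla> Id C A) p"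
    and [simp]: "h \<in> Arr C" "Dom C h = E \<oplus> E" "Cod C h = Dom C p\<^sub>0"
    and h: "p\<^sub>0 \<cdot> h = p \<boxplus> p" "q\<^sub>0 \<cdot> h = Id C E \<nabla> Id C E" "regular_epi C h"
    unfolding feeble_pullback_def by (auto simp: hom_def)
  note [simp] = pullbackD(1,2,5)[OF pb\<^sub>0]
  have [simp]: "Cod C p\<^sub>0 = A \<oplus> A" "Cod C q\<^sub>0 = E" using pullbackD(6,7)[OF pb\<^sub>0] by simp_all
  \<comment> \<open>Clause (d) concerns codiagonals only. Factoring [1, m] through [1, 1] turns
    \<open>w\<close> into an element of \<open>A \<oplus> A\<close> lying over the same point as
    \<open>y\<close>, to which the cover \<open>h\<close> by \<open>E \<oplus> E\<close>
    applies.\<close>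
  have "(Id C A \<nabla> Id C A) \<cdot> (Id C A \<boxplus> m) = Id C A \<nabla> m" by (simp add: fsum_def)
  from comp_eq_arr[OF this, of w] have "(Id C A \<nabla> Id C A) \<cdot> ((Id C A \<boxplus> m) \<cdot> w) = p \<cdot> y"
    using eq by simp
  then obtain g where [simp]: "g \<in> Arr C" "Dom C g = T" "Cod C g = Dom C p\<^sub>0"
    and g: "p\<^sub>0 \<cdot> g = (Id C A \<boxplus> m) \<cdot> w" "q\<^sub>0 \<cdot> g = y"
    using pullback_factor[OF pb\<^sub>0, of "(Id C A \<boxplus> m) \<cdot> w" y] by auto
  obtain e \<rho> where e: "regular_epi C e" and [simp]: "e \<in> Arr C" "\<rho> \<in> Arr C" "Cod C e = T"
      "Dom C \<rho> = Dom C e" "Cod C \<rho> = E \<oplus> E" and \<rho>: "h \<cdot> \<rho> = g \<cdot> e"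
    using cover_lift[OF h(3), of g] by auto
  have \<rho>1: "(p \<boxplus> p) \<cdot> \<rho> = (Id C A \<boxplus> m) \<cdot> (w \<cdot> e)"
    using comp_eq_arr[OF h(1), of \<rho>] comp_eq_comp[OF g(1), of e] \<rho> by simp
  have \<rho>2: "(Id C E \<nabla> Id C E) \<cdot> \<rho> = y \<cdot> e"
    using comp_eq_arr[OF h(2), of \<rho>] comp_eq_arr[OF g(2), of e] \<rho> by simp
  \<comment> \<open>It remains to restrict from \<open>A \<oplus> A\<close> back to
    \<open>A \<oplus> S\<close>. By (b) this is computed summandwise, and the second summand becomes
    the given pullback of \<open>p\<close> and \<open>m\<close>.\<close>
  have "is_pullback C (p \<boxplus> \<pi>\<^sub>S) (Id C E \<boxplus> \<pi>\<^sub>E) (Id C A \<boxplus> m) (p \<boxplus> p)"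
    by (intro pullback_fsum pullback_id_horizontal pullback_sym[OF pb]) simp_all
  from pullback_factor[OF this, of "w \<cdot> e" \<rho>]
  obtain \<tau> where [simp]: "\<tau> \<in> Arr C" "Dom C \<tau> = Dom C e" "Cod C \<tau> = E \<oplus> Dom C \<pi>\<^sub>E"
    and \<tau>: "(p \<boxplus> \<pi>\<^sub>S) \<cdot> \<tau> = w \<cdot> e" "(Id C E \<boxplus> \<pi>\<^sub>E) \<cdot> \<tau> = \<rho>"
    using \<rho>1 by auto
  have "(Id C E \<nabla> Id C E) \<cdot> (Id C E \<boxplus> \<pi>\<^sub>E) = Id C E \<nabla> \<pi>\<^sub>E" by (simp add: fsum_def)
  from comp_eq_arr[OF this, of \<tau>] have "(Id C E \<nabla> \<pi>\<^sub>E) \<cdot> \<tau> = y \<cdot> e" using \<tau>(2) \<rho>2 by simp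
  thus ?thesis using that[of e \<tau>] e \<tau>(1) by simp
qed

end


section \<open>The equivalence relation of a span with a monic leg\<close>

locale mono_span = condition_P_cat C for C :: "('o, 'a) cat" (structure) +
  fixes S A B m f
  assumes exact: "exact_category C"
    and m_mono: "is_mono C m" and m_hom: "m \<in> hom C S A" and f_hom: "f \<in> hom C S B"
begin

section \<open>The reflexive graph and its pullback squares\<close>

lemma span_arr [simp]: "m \<in> Arr C" "f \<in> Arr C" "Dom C m = S" "Cod C m = A" "Dom C f = S" "Cod C f = B"
  using m_hom f_hom by (auto simp: hom_def)

lemma span_obj [simp]: "S \<in> Obj C" "A \<in> Obj C" "B \<in> Obj C"
  using arr_obj(1)[of m] arr_obj(2)[of m] arr_obj(2)[of f] by simp_all

abbreviation "D \<equiv> A \<oplus> S \<oplus> B"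

definition d where "d = (Id C A \<nabla> m) \<boxplus> Id C B"

definition c where "c = (inl A B \<nabla> inr A B \<cdot> f) \<nabla> inr A B"

text \<open>This is \<open>c\<close> with \<open>S\<close> bracketed to \<open>B\<close> instead of
  \<open>A\<close>. In this form it is a sum of two arrows, as \<open>d\<close> is in the other
  bracketing, so (b) computes pullbacks along it.\<close>

definition c' where "c' = Id C A \<boxplus> (f \<nabla> Id C B)"

text \<open>The associativity isomorphism between the bracketings used by \<open>d\<close> and by
  \<open>c'\<close>; \<open>\<alpha>'\<close> goes back.\<close>

definition \<alpha> where
  "\<alpha> = (inl A (S \<oplus> B) \<nabla> inr A (S \<oplus> B) \<cdot> inl S B) \<nabla> inr A (S \<oplus> B) \<cdot> inr S B"

definition \<alpha>' where
  "\<alpha>' = inl (A \<oplus> S) B \<cdot> inl A S \<nabla> (inl (A \<oplus> S) B \<cdot> inr A S \<nabla> inr (A \<oplus> S) B)"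

definition \<mu> where "\<mu> = m \<boxplus> Id C B"

text \<open>A retraction of \<open>inr S B\<close> that is \<open>f\<close> on \<open>S\<close>: it
  assigns to an element of the subobject \<open>\<mu>\<close> its representative in
  \<open>B\<close>.\<close>

definition r where "r = f \<nabla> Id C B"

lemma graph_arr [simp]:
  "d \<in> Arr C" "Dom C d = D" "Cod C d = A \<oplus> B"
  "c \<in> Arr C" "Dom C c = D" "Cod C c = A \<oplus> B"
  "c' \<in> Arr C" "Dom C c' = A \<oplus> (S \<oplus> B)" "Cod C c' = A \<oplus> B"
  "\<alpha> \<in> Arr C" "Dom C \<alpha> = D" "Cod C \<alpha> = A \<oplus> (S \<oplus> B)"
  "\<alpha>' \<in> Arr C" "Dom C \<alpha>' = A \<oplus> (S \<oplus> B)" "Cod C \<alpha>' = D"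
  "\<mu> \<in> Arr C" "Dom C \<mu> = S \<oplus> B" "Cod C \<mu> = A \<oplus> B"
  "r \<in> Arr C" "Dom C r = S \<oplus> B" "Cod C r = B"
  by (simp_all add: d_def c_def c'_def \<alpha>_def \<alpha>'_def \<mu>_def r_def)

lemma c'_\<alpha>: "c' \<cdot> \<alpha> = c"
  by (simp add: c'_def \<alpha>_def c_def fsum_def)

text \<open>Reassembles an injection that has been split into its two components, the one
  simplification that normalising to copairings does not make by itself.\<close>

lemma junc_inj_assoc:
  "\<lbrakk>X \<in> Obj C; Y \<in> Obj C; Z \<in> Obj C\<rbrakk> \<Longrightarrow>
    inl (X \<oplus> Y) Z \<cdot> inl X Y \<nabla> inl (X \<oplus> Y) Z \<cdot> inr X Y = inl (X \<oplus> Y) Z"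
  using comp_junc[of "inl X Y" "inr X Y" "inl (X \<oplus> Y) Z"] by simp

lemma \<alpha>'_\<alpha>: "\<alpha>' \<cdot> \<alpha> = Id C D"
  by (simp add: \<alpha>_def \<alpha>'_def junc_inj_assoc)

lemma \<alpha>_eqD:
  assumes "w \<in> Arr C" "Cod C w = D" "x \<in> Arr C" "Cod C x = A \<oplus> (S \<oplus> B)" "\<alpha> \<cdot> w = x"
  shows "w = \<alpha>' \<cdot> x"
  using comp_eq_arr[OF \<alpha>'_\<alpha>, of w] assms by simp

lemma mu_mono: "is_mono C \<mu>"
proof -
  have "is_mono C (Id C B)" by (rule monoI) auto
  thus ?thesis using mono_fsum[OF m_mono] by (simp add: \<mu>_def)
qed

text \<open>The left summand is the square of (c) for \<open>m\<close>, the right one is trivial. So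
  (a, s, b) with a + m s in \<open>S\<close> must have a in \<open>S\<close>.\<close>

lemma pullback_d_mu:
  "is_pullback C ((m \<boxplus> Id C S) \<boxplus> Id C B) ((Id C S \<nabla> Id C S) \<boxplus> Id C B) d \<mu>"
  unfolding d_def \<mu>_def
  by (intro pullback_fsum pullback_mono_copair m_mono pullback_id_vertical) simp_all

lemma pullback_c'_mu:
  "is_pullback C (m \<boxplus> Id C (S \<oplus> B)) (Id C S \<boxplus> (f \<nabla> Id C B)) c' \<mu>"
  unfolding c'_def \<mu>_def
  by (intro pullback_fsum pullback_id_horizontal pullback_id_vertical) simp_all

text \<open>This is the object of composable pairs of the graph. In each summand one of the two
  arrows is an identity, so (b) gives it exactly, without a cover.\<close>

lemma pullback_c'_d:
  "is_pullback C ((Id C A \<nabla> m) \<boxplus> Id C (S \<oplus> B)) (Id C (A \<oplus> S) \<boxplus> (f \<nabla> Id C B)) c' d"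
  unfolding c'_def d_def
  by (intro pullback_fsum pullback_id_horizontal pullback_id_vertical) simp_all

text \<open>(b) holds for every choice of coproducts, and \<open>X\<close> is itself a coproduct of
  \<open>X\<close> and the initial object \<open>Z\<close>. The square is then the sum of a trivial
  square on \<open>m\<close> and the square from \<open>Z\<close> to \<open>B\<close>.\<close>

lemma pullback_inl_mu: "is_pullback C m (inl S B) (inl A B) \<mu>"
proof -
  obtain Z where Z[simp]: "Z \<in> Obj C" and init: "\<And>T. T \<in> Obj C \<Longrightarrow> \<exists>!h. h \<in> hom C Z T"
    using initial_exists by blast
  define z where "z T = (THE h. h \<in> hom C Z T)" for T
  have z[simp]: "z T \<in> Arr C" "Dom C (z T) = Z" "Cod C (z T) = T" if "T \<in> Obj C" for T
    using theI'[OF init[OF that]] by (auto simp: z_def hom_def)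
  have z_eq: "h = z T" if "h \<in> hom C Z T" for h T
    using that the1_equality[OF init, of T h] arr_obj(2)[of h] by (auto simp: z_def hom_def)
  have cop: "binary_coproduct C X Z (Id C X) (z X)" if [simp]: "X \<in> Obj C" for X
    unfolding binary_coproduct_def
  proof (intro exI[of _ X] conjI allI ballI)
    fix T u v assume uv: "u \<in> hom C X T" "v \<in> hom C Z T"
    show "\<exists>!h. h \<in> hom C X T \<and> h \<cdot> Id C X = u \<and> h \<cdot> z X = v"
    proof (rule ex1I[of _ u])
      have "u \<cdot> z X = v"
        using z_eq[of v T] z_eq[of "u \<cdot> z X" T] uv by (simp add: hom_def)
      thus "u \<in> hom C X T \<and> u \<cdot> Id C X = u \<and> u \<cdot> z X = v" using uv by (simp add: hom_def)
    qed (auto simp: hom_def)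
  qed (simp_all add: hom_def)
  have pb: "is_pullback C (Id C Z) (z B) (z B) (Id C B)" by (rule pullback_id_vertical) simp_all
  have pbm: "is_pullback C m (Id C S) (Id C A) m" by (rule pullback_id_horizontal) simp_all
  have "coproducts_preserve_pullbacks C" using condition_P by (simp add: condition_P_def)
  moreover have "binary_coproduct C (Dom C m) (Dom C (Id C Z)) (Id C S) (z S)"
    "binary_coproduct C (Cod C m) (Cod C (Id C Z)) (Id C A) (z A)"
    "binary_coproduct C (Cod C (Id C S)) (Cod C (z B)) (inl S B) (inr S B)"
    "binary_coproduct C (Cod C (Id C A)) (Cod C (z B)) (inl A B) (inr A B)"
    by (simp_all add: cop binary_coproduct_inl_inr)
  ultimately have pbs: "is_pullback C
      (arrow_sum C (Id C S) (z S) (Id C A) (z A) m (Id C Z))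
      (arrow_sum C (Id C S) (z S) (inl S B) (inr S B) (Id C S) (z B))
      (arrow_sum C (Id C A) (z A) (inl A B) (inr A B) (Id C A) (z B))
      (arrow_sum C (inl S B) (inr S B) (inl A B) (inr A B) m (Id C B))"
    using pb pbm unfolding coproducts_preserve_pullbacks_def by blast
  have eq: "copair C (Id C X) (z X) u v = u" if "u \<in> Arr C" "Dom C u = X" "v \<in> Arr C" "Dom C v = Z"
    "Cod C v = Cod C u" "X \<in> Obj C" for X u v
  proof -
    note c = binary_coproduct_copair[OF cop, of X u v]
    show ?thesis using c(1,2,4) that by simp
  qed
  have "arrow_sum C (Id C S) (z S) (Id C A) (z A) m (Id C Z) = m"
    "arrow_sum C (Id C S) (z S) (inl S B) (inr S B) (Id C S) (z B) = inl S B"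
    "arrow_sum C (Id C A) (z A) (inl A B) (inr A B) (Id C A) (z B) = inl A B"
    "arrow_sum C (inl S B) (inr S B) (inl A B) (inr A B) m (Id C B) = \<mu>"
    using fsum_eq_arrow_sum[of m "Id C B"] by (simp_all add: arrow_sum_def eq \<mu>_def)
  thus ?thesis using pbs by simp
qed

text \<open>A composable pair comes from an element ((a, s), (s', b)): \<open>w\<close> is (a + m s,
  s', b) and \<open>v\<close> is (a, s, f s' + b).\<close>

lemma graph_trans:
  assumes [simp]: "w \<in> Arr C" "v \<in> Arr C" "Cod C w = D" "Cod C v = D" "Dom C w = T" "Dom C v = T"
    and eq: "c \<cdot> w = d \<cdot> v"
  obtains t where "t \<in> Arr C" "Dom C t = T" "Cod C t = D" "d \<cdot> t = d \<cdot> w" "c \<cdot> t = c \<cdot> v"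
proof -
  have "c' \<cdot> (\<alpha> \<cdot> w) = d \<cdot> v" using comp_eq_arr[OF c'_\<alpha>, of w] eq by simp
  then obtain \<tau> where [simp]: "\<tau> \<in> Arr C" "Dom C \<tau> = T" "Cod C \<tau> = (A \<oplus> S) \<oplus> (S \<oplus> B)"
    and \<tau>1: "((Id C A \<nabla> m) \<boxplus> Id C (S \<oplus> B)) \<cdot> \<tau> = \<alpha> \<cdot> w"
    and \<tau>2: "(Id C (A \<oplus> S) \<boxplus> (f \<nabla> Id C B)) \<cdot> \<tau> = v"
    using pullback_factor[OF pullback_c'_d, of "\<alpha> \<cdot> w" v] by auto
  \<comment> \<open>The composite arrow moves s and s' at once: \<open>k\<close> sends ((a, s), (s',
    b)) to (a, s + s', b).\<close>
  define k where "k = inl (A \<oplus> S) B \<nabla> (inl (A \<oplus> S) B \<cdot> inr A S \<nabla> inr (A \<oplus> S) B)"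
  have [simp]: "k \<in> Arr C" "Dom C k = (A \<oplus> S) \<oplus> (S \<oplus> B)" "Cod C k = D" by (simp_all add: k_def)
  have dk: "d \<cdot> k = d \<cdot> \<alpha>' \<cdot> ((Id C A \<nabla> m) \<boxplus> Id C (S \<oplus> B))"
    by (simp add: d_def k_def \<alpha>'_def fsum_def)
  have ck: "c \<cdot> k = c \<cdot> (Id C (A \<oplus> S) \<boxplus> (f \<nabla> Id C B))"
    by (simp add: c_def k_def fsum_def)
  have "w = \<alpha>' \<cdot> (((Id C A \<nabla> m) \<boxplus> Id C (S \<oplus> B)) \<cdot> \<tau>)" using \<alpha>_eqD \<tau>1 by simp
  hence "d \<cdot> (k \<cdot> \<tau>) = d \<cdot> w" using comp_eq_comp[OF dk, of \<tau>] by simp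
  moreover have "c \<cdot> (k \<cdot> \<tau>) = c \<cdot> v" using comp_eq_comp[OF ck, of \<tau>] \<tau>2 by simp
  ultimately show ?thesis using that[of "k \<cdot> \<tau>"] by simp
qed

text \<open>A valley is followed from one end to the other: down \<open>w\<close> by the pullback of
  \<open>d\<close> along \<open>\<mu>\<close>, then up \<open>w'\<close> by the pullback of
  \<open>c'\<close> along \<open>\<mu>\<close>. Neither step leaves \<open>S \<oplus> B\<close>, and
  both preserve \<open>r\<close>.\<close>

lemma saturation:
  assumes [simp]: "w \<in> Arr C" "w' \<in> Arr C" "Cod C w = D" "Cod C w' = D" "Dom C w = T" "Dom C w' = T"
    "x \<in> Arr C" "Dom C x = T" "Cod C x = S \<oplus> B"
    and x: "d \<cdot> w = \<mu> \<cdot> x" and eq: "c \<cdot> w = c \<cdot> w'"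
  obtains y where "y \<in> Arr C" "Dom C y = T" "Cod C y = S \<oplus> B" "d \<cdot> w' = \<mu> \<cdot> y" "r \<cdot> y = r \<cdot> x"
proof -
  obtain \<sigma> where [simp]: "\<sigma> \<in> Arr C" "Dom C \<sigma> = T" "Cod C \<sigma> = S \<oplus> S \<oplus> B"
    and \<sigma>: "((m \<boxplus> Id C S) \<boxplus> Id C B) \<cdot> \<sigma> = w" "((Id C S \<nabla> Id C S) \<boxplus> Id C B) \<cdot> \<sigma> = x"
    using pullback_factor[OF pullback_d_mu, of w x] x by auto
  \<comment> \<open>The pullback gives \<open>w\<close> = (m s, s', b) with \<open>x\<close> = (s +
    s', b); \<open>\<zeta>\<close> is \<open>c\<close> restricted to such triples, sending (s, s',
    b) to (s, f s' + b).\<close>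
  define \<zeta> where "\<zeta> = (inl S B \<nabla> inr S B \<cdot> f) \<nabla> inr S B"
  have [simp]: "\<zeta> \<in> Arr C" "Dom C \<zeta> = S \<oplus> S \<oplus> B" "Cod C \<zeta> = S \<oplus> B" by (simp_all add: \<zeta>_def)
  have "c \<cdot> ((m \<boxplus> Id C S) \<boxplus> Id C B) = \<mu> \<cdot> \<zeta>"
    by (simp add: c_def \<mu>_def \<zeta>_def fsum_def)
  from comp_eq_comp[OF this, of \<sigma>] have "c' \<cdot> (\<alpha> \<cdot> w') = \<mu> \<cdot> (\<zeta> \<cdot> \<sigma>)"
    using comp_eq_arr[OF c'_\<alpha>, of w'] \<sigma> eq by simp
  then obtain \<sigma>' where [simp]: "\<sigma>' \<in> Arr C" "Dom C \<sigma>' = T" "Cod C \<sigma>' = S \<oplus> (S \<oplus> B)"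
    and \<sigma>': "(m \<boxplus> Id C (S \<oplus> B)) \<cdot> \<sigma>' = \<alpha> \<cdot> w'" "(Id C S \<boxplus> (f \<nabla> Id C B)) \<cdot> \<sigma>' = \<zeta> \<cdot> \<sigma>"
    using pullback_factor[OF pullback_c'_mu, of "\<alpha> \<cdot> w'" "\<zeta> \<cdot> \<sigma>"] by auto
  \<comment> \<open>Here \<open>w'\<close> = (m s, s', b) for the element \<open>\<sigma>'\<close> =
    (s, (s', b)), and \<open>\<eta>\<close> is the restriction of \<open>d\<close>, sending it to (s
    + s', b).\<close>
  define \<eta> where "\<eta> = inl S B \<nabla> Id C (S \<oplus> B)"
  have [simp]: "\<eta> \<in> Arr C" "Dom C \<eta> = S \<oplus> (S \<oplus> B)" "Cod C \<eta> = S \<oplus> B" by (simp_all add: \<eta>_def)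
  have "d \<cdot> \<alpha>' \<cdot> (m \<boxplus> Id C (S \<oplus> B)) = \<mu> \<cdot> \<eta>"
    by (simp add: d_def \<alpha>'_def \<mu>_def \<eta>_def fsum_def)
  from comp_eq_comp[OF this, of \<sigma>'] have 1: "d \<cdot> w' = \<mu> \<cdot> (\<eta> \<cdot> \<sigma>')"
    using \<alpha>_eqD[of w'] \<sigma>' by simp
  have "r \<cdot> \<eta> = r \<cdot> (Id C S \<boxplus> (f \<nabla> Id C B))" "r \<cdot> \<zeta> = r \<cdot> ((Id C S \<nabla> Id C S) \<boxplus> Id C B)"
    by (simp_all add: r_def \<eta>_def \<zeta>_def fsum_def)
  from comp_eq_comp[OF this(1), of \<sigma>'] comp_eq_comp[OF this(2), of \<sigma>]
  have "r \<cdot> (\<eta> \<cdot> \<sigma>') = r \<cdot> x" using \<sigma> \<sigma>' by simp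
  with 1 show ?thesis using that[of "\<eta> \<cdot> \<sigma>'"] by simp
qed

section \<open>Confluence of the graph\<close>

text \<open>On elements, \<open>k\<^sub>1 ((a, s), (s', s''), b) = (a + m s', s + s'', b)\<close> and
  \<open>k\<^sub>2 ((a, s), (s', s''), b) = (a + m s, s' + s'', b)\<close>.\<close>

definition k\<^sub>1 where "k\<^sub>1 = (Id C (A \<oplus> S) \<nabla> (m \<boxplus> Id C S)) \<boxplus> Id C B"

definition k\<^sub>2 where "k\<^sub>2 = ((Id C A \<nabla> m) \<boxplus> (Id C S \<nabla> Id C S)) \<boxplus> Id C B"

lemma k_arr [simp]:
  "k\<^sub>1 \<in> Arr C" "Dom C k\<^sub>1 = A \<oplus> S \<oplus> (S \<oplus> S) \<oplus> B" "Cod C k\<^sub>1 = D"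
  "k\<^sub>2 \<in> Arr C" "Dom C k\<^sub>2 = A \<oplus> S \<oplus> (S \<oplus> S) \<oplus> B" "Cod C k\<^sub>2 = D"
  by (simp_all add: k\<^sub>1_def k\<^sub>2_def)

text \<open>By (b) the kernel pair of \<open>d\<close> is K + B, with K the kernel pair of p =
  [1, m]. K is also the pullback of [1, m] along p, so \<open>cover_pullback_copair\<close> covers
  it by (A + S) + P, where P is the pullback of p and \<open>m\<close>; by (c), P is S + S.\<close>

lemma cover_kernel_pair_d:
  assumes [simp]: "w \<in> Arr C" "v \<in> Arr C" "Cod C w = D" "Cod C v = D" "Dom C w = T" "Dom C v = T"
    and eq: "d \<cdot> w = d \<cdot> v"
  obtains e \<tau> where "regular_epi C e" "e \<in> Arr C" "Cod C e = T" "\<tau> \<in> Arr C"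
    "Dom C \<tau> = Dom C e" "Cod C \<tau> = A \<oplus> S \<oplus> (S \<oplus> S) \<oplus> B" "k\<^sub>1 \<cdot> \<tau> = w \<cdot> e" "k\<^sub>2 \<cdot> \<tau> = v \<cdot> e"
proof -
  define p where "p = Id C A \<nabla> m"
  have [simp]: "p \<in> Arr C" "Dom C p = A \<oplus> S" "Cod C p = A" by (simp_all add: p_def)
  \<comment> \<open>\<open>p\<close> is split by the first injection, so (d) applies to it.\<close>
  have p_epi: "regular_epi C p" by (rule regular_epi_split[of _ "inl A S"]) (simp_all add: p_def)
  have pb: "is_pullback C (m \<boxplus> Id C S) (Id C S \<nabla> Id C S) p m"
    unfolding p_def by (rule pullback_mono_copair[OF m_mono]) simp_all
  obtain y z where ker: "is_pullback C y z p p" using pullback_exists[of p p] by auto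
  define K where "K = Dom C y"
  have [simp]: "y \<in> Arr C" "z \<in> Arr C" "Dom C y = K" "Dom C z = K" "Cod C y = A \<oplus> S" "Cod C z = A \<oplus> S"
    "K \<in> Obj C"
    using pullbackD(1,2,5-7)[OF ker] by (simp_all add: K_def)
  have yz: "p \<cdot> y = (Id C A \<nabla> m) \<cdot> z" using pullbackD(9)[OF ker] by (simp add: p_def)
  obtain e \<tau> where e: "regular_epi C e" and [simp]: "e \<in> Arr C" "Cod C e = K" "\<tau> \<in> Arr C"
    "Dom C \<tau> = Dom C e" and cod: "Cod C \<tau> = A \<oplus> S \<oplus> Dom C (m \<boxplus> Id C S)"
    and \<tau>: "(p \<boxplus> (Id C S \<nabla> Id C S)) \<cdot> \<tau> = z \<cdot> e" "(Id C (A \<oplus> S) \<nabla> (m \<boxplus> Id C S)) \<cdot> \<tau> = y \<cdot> e"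
    by (rule cover_pullback_copair[OF p_epi pb, of "A \<oplus> S" A S y K z]) (use yz that in simp_all)
  have [simp]: "Cod C \<tau> = A \<oplus> S \<oplus> (S \<oplus> S)" using cod by simp
  have pbK: "is_pullback C (y \<boxplus> Id C B) (z \<boxplus> Id C B) d d"
    unfolding d_def p_def[symmetric] by (intro pullback_fsum ker pullback_id_vertical) simp_all
  obtain g where [simp]: "g \<in> Arr C" "Dom C g = T" "Cod C g = K \<oplus> B"
    and g: "(y \<boxplus> Id C B) \<cdot> g = w" "(z \<boxplus> Id C B) \<cdot> g = v"
    using pullback_factor[OF pbK, of w v] eq by auto
  have "regular_epi C (e \<boxplus> Id C B)" using regular_epi_fsum_id[OF e] by simp
  then obtain t \<rho> where t: "regular_epi C t" and [simp]: "t \<in> Arr C" "\<rho> \<in> Arr C" "Cod C t = T"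
      "Dom C \<rho> = Dom C t" "Cod C \<rho> = Dom C e \<oplus> B" and \<rho>: "(e \<boxplus> Id C B) \<cdot> \<rho> = g \<cdot> t"
    using cover_lift[of "e \<boxplus> Id C B" g] by auto
  have "k\<^sub>1 \<cdot> (\<tau> \<boxplus> Id C B) = (y \<boxplus> Id C B) \<cdot> (e \<boxplus> Id C B)"
    "k\<^sub>2 \<cdot> (\<tau> \<boxplus> Id C B) = (z \<boxplus> Id C B) \<cdot> (e \<boxplus> Id C B)"
    unfolding k\<^sub>1_def k\<^sub>2_def p_def[symmetric] by (simp_all add: fsum_comp \<tau>)
  from this[THEN comp_eq_comp, of \<rho>]
  have "k\<^sub>1 \<cdot> ((\<tau> \<boxplus> Id C B) \<cdot> \<rho>) = w \<cdot> t" "k\<^sub>2 \<cdot> ((\<tau> \<boxplus> Id C B) \<cdot> \<rho>) = v \<cdot> t"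
    using comp_eq_arr[OF g(1), of t] comp_eq_arr[OF g(2), of t] \<rho> by simp_all
  thus ?thesis using that[of t "(\<tau> \<boxplus> Id C B) \<cdot> \<rho>"] t by simp
qed

text \<open>On the cover of the kernel pair of \<open>d\<close> both decompositions of the element
  have a common refinement by s, s', s''. Each target can then be rewritten further by moving the
  part that the other arrow has already moved.\<close>

lemma graph_confluent:
  assumes [simp]: "w \<in> Arr C" "v \<in> Arr C" "Cod C w = D" "Cod C v = D" "Dom C w = T" "Dom C v = T"
    and eq: "d \<cdot> w = d \<cdot> v"
  obtains e w' v' where "regular_epi C e" "e \<in> Arr C" "Cod C e = T" "w' \<in> Arr C" "v' \<in> Arr C"
    "Dom C w' = Dom C e" "Dom C v' = Dom C e" "Cod C w' = D" "Cod C v' = D"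
    "d \<cdot> w' = c \<cdot> (w \<cdot> e)" "d \<cdot> v' = c \<cdot> (v \<cdot> e)" "c \<cdot> w' = c \<cdot> v'"
proof -
  obtain e \<tau> where e: "regular_epi C e" and [simp]: "e \<in> Arr C" "Cod C e = T" "\<tau> \<in> Arr C"
    "Dom C \<tau> = Dom C e" "Cod C \<tau> = A \<oplus> S \<oplus> (S \<oplus> S) \<oplus> B"
    and \<tau>: "k\<^sub>1 \<cdot> \<tau> = w \<cdot> e" "k\<^sub>2 \<cdot> \<tau> = v \<cdot> e"
    by (rule cover_kernel_pair_d[OF assms]) (use that in simp_all)
  define i j where "i = inl (A \<oplus> S) B" and "j = inr (A \<oplus> S) B"
  have [simp]: "i \<in> Arr C" "j \<in> Arr C" "Dom C i = A \<oplus> S" "Dom C j = B" "Cod C i = D" "Cod C j = D"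
    by (simp_all add: i_def j_def)
  \<comment> \<open>On ((a, s), (s', s''), b), \<open>l\<^sub>1\<close> is (a, s', f s + f s'' + b)
    and \<open>l\<^sub>2\<close> is (a, s, f s' + f s'' + b). Under \<open>c\<close> both become (a,
    f s + f s' + f s'' + b).\<close>
  define l\<^sub>1 where "l\<^sub>1 = ((i \<cdot> inl A S \<nabla> j \<cdot> f) \<nabla> (i \<cdot> inr A S \<nabla> j \<cdot> f)) \<nabla> j"
  define l\<^sub>2 where "l\<^sub>2 = (i \<nabla> (j \<cdot> f \<nabla> j \<cdot> f)) \<nabla> j"
  have [simp]: "l\<^sub>1 \<in> Arr C" "Dom C l\<^sub>1 = A \<oplus> S \<oplus> (S \<oplus> S) \<oplus> B" "Cod C l\<^sub>1 = D"
    "l\<^sub>2 \<in> Arr C" "Dom C l\<^sub>2 = A \<oplus> S \<oplus> (S \<oplus> S) \<oplus> B" "Cod C l\<^sub>2 = D"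
    by (simp_all add: l\<^sub>1_def l\<^sub>2_def)
  have l: "d \<cdot> l\<^sub>1 = c \<cdot> k\<^sub>1" "d \<cdot> l\<^sub>2 = c \<cdot> k\<^sub>2" "c \<cdot> l\<^sub>1 = c \<cdot> l\<^sub>2"
    by (simp_all add: l\<^sub>1_def l\<^sub>2_def d_def c_def k\<^sub>1_def k\<^sub>2_def fsum_def i_def j_def)
  show ?thesis
    using that[of e "l\<^sub>1 \<cdot> \<tau>" "l\<^sub>2 \<cdot> \<tau>"] e l[THEN comp_eq_comp, of \<tau>] \<tau> by simp
qed

section \<open>The equivalence relation and its quotient\<close>

text \<open>\<open>R\<^sup>\<circ>R\<close> for the image \<open>R\<close> of \<open>(d, c)\<close>, read on generalised elements.\<close>

definition rel where
  "rel x y \<longleftrightarrow> (\<exists>t w w'. regular_epi C t \<and> Cod C t = Dom C x \<and> w \<in> Arr C \<and> w' \<in> Arr C \<and>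
     Dom C w = Dom C t \<and> Dom C w' = Dom C t \<and> Cod C w = D \<and> Cod C w' = D \<and>
     d \<cdot> w = x \<cdot> t \<and> d \<cdot> w' = y \<cdot> t \<and> c \<cdot> w = c \<cdot> w')"

lemma relI:
  assumes "regular_epi C t" "Cod C t = Dom C x" "w \<in> Arr C" "w' \<in> Arr C" "Dom C w = Dom C t"
    "Dom C w' = Dom C t" "Cod C w = D" "Cod C w' = D" "d \<cdot> w = x \<cdot> t" "d \<cdot> w' = y \<cdot> t" "c \<cdot> w = c \<cdot> w'"
  shows "rel x y"
  using assms unfolding rel_def by blast

lemma relE:
  assumes "rel x y"
  obtains t w w' where "regular_epi C t" "t \<in> Arr C" "Cod C t = Dom C x" "w \<in> Arr C" "w' \<in> Arr C"
    "Dom C w = Dom C t" "Dom C w' = Dom C t" "Cod C w = D" "Cod C w' = D"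
    "d \<cdot> w = x \<cdot> t" "d \<cdot> w' = y \<cdot> t" "c \<cdot> w = c \<cdot> w'"
proof -
  obtain t w w' where *: "regular_epi C t \<and> Cod C t = Dom C x \<and> w \<in> Arr C \<and> w' \<in> Arr C \<and>
     Dom C w = Dom C t \<and> Dom C w' = Dom C t \<and> Cod C w = D \<and> Cod C w' = D \<and>
     d \<cdot> w = x \<cdot> t \<and> d \<cdot> w' = y \<cdot> t \<and> c \<cdot> w = c \<cdot> w'"
    using assms unfolding rel_def by blast
  show ?thesis by (rule that[of t w w']) (use * regular_epi_arr in simp_all)
qed

lemma rel_sym:
  assumes "rel x y" "Dom C x = Dom C y"
  shows "rel y x"
proof -
  obtain t w w' where "regular_epi C t" "Cod C t = Dom C x" "w \<in> Arr C" "w' \<in> Arr C"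
    "Dom C w = Dom C t" "Dom C w' = Dom C t" "Cod C w = D" "Cod C w' = D"
    "d \<cdot> w = x \<cdot> t" "d \<cdot> w' = y \<cdot> t" "c \<cdot> w = c \<cdot> w'"
    by (rule relE[OF assms(1)])
  thus ?thesis using assms(2) by (intro relI[of t y w' w]) simp_all
qed

lemma rel_refl: "rel (Id C (A \<oplus> B)) (Id C (A \<oplus> B))"
proof -
  \<comment> \<open>The section of \<open>d\<close> with empty \<open>S\<close> component, used for
    both legs of the valley.\<close>
  define i where "i = inl (A \<oplus> S) B \<cdot> inl A S \<nabla> inr (A \<oplus> S) B"
  show ?thesis
    by (rule relI[of "Id C (A \<oplus> B)" _ i i]) (simp_all add: i_def d_def fsum_def regular_epi_id)
qed

text \<open>Of the two valleys, the legs issuing from \<open>y\<close> form a peak once restricted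
  to a common cover. Confluence replaces that peak by a valley, and \<open>graph_trans\<close>
  composes its legs with the outer legs from \<open>x\<close> and \<open>z\<close>.\<close>

lemma rel_trans:
  assumes [simp]: "x \<in> Arr C" "y \<in> Arr C" "z \<in> Arr C" "Dom C x = T" "Dom C y = T" "Dom C z = T"
    "Cod C x = A \<oplus> B" "Cod C y = A \<oplus> B" "Cod C z = A \<oplus> B"
    and xy: "rel x y" and yz: "rel y z"
  shows "rel x z"
proof -
  obtain t w\<^sub>1 w\<^sub>1' where t: "regular_epi C t" and t_arr[simp]: "t \<in> Arr C" "Cod C t = T"
    "w\<^sub>1 \<in> Arr C" "w\<^sub>1' \<in> Arr C" "Dom C w\<^sub>1 = Dom C t" "Dom C w\<^sub>1' = Dom C t" "Cod C w\<^sub>1 = D" "Cod C w\<^sub>1' = D"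
    and w1: "d \<cdot> w\<^sub>1 = x \<cdot> t" "d \<cdot> w\<^sub>1' = y \<cdot> t" "c \<cdot> w\<^sub>1 = c \<cdot> w\<^sub>1'"
    by (rule relE[OF xy]) (use that in simp_all)
  obtain u w\<^sub>2 w\<^sub>2' where u: "regular_epi C u" and u_arr[simp]: "u \<in> Arr C" "Cod C u = T"
    "w\<^sub>2 \<in> Arr C" "w\<^sub>2' \<in> Arr C" "Dom C w\<^sub>2 = Dom C u" "Dom C w\<^sub>2' = Dom C u" "Cod C w\<^sub>2 = D" "Cod C w\<^sub>2' = D"
    and w2: "d \<cdot> w\<^sub>2 = y \<cdot> u" "d \<cdot> w\<^sub>2' = z \<cdot> u" "c \<cdot> w\<^sub>2 = c \<cdot> w\<^sub>2'"
    by (rule relE[OF yz]) (use that in simp_all)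
  obtain t' u' where t': "regular_epi C t'" and [simp]: "t' \<in> Arr C" "u' \<in> Arr C" "Cod C t' = Dom C t"
    "Dom C u' = Dom C t'" "Cod C u' = Dom C u" and tu: "u \<cdot> u' = t \<cdot> t'"
    using cover_lift[OF u, of t] by auto
  have "d \<cdot> (w\<^sub>1' \<cdot> t') = d \<cdot> (w\<^sub>2 \<cdot> u')"
    using comp_eq_comp[OF w1(2), of t'] comp_eq_comp[OF w2(1), of u'] tu by simp
  then obtain e v\<^sub>1 v\<^sub>2 where e: "regular_epi C e" and [simp]: "e \<in> Arr C" "Cod C e = Dom C t'"
    "v\<^sub>1 \<in> Arr C" "v\<^sub>2 \<in> Arr C" "Dom C v\<^sub>1 = Dom C e" "Dom C v\<^sub>2 = Dom C e" "Cod C v\<^sub>1 = D" "Cod C v\<^sub>2 = D"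
    and v: "d \<cdot> v\<^sub>1 = c \<cdot> ((w\<^sub>1' \<cdot> t') \<cdot> e)" "d \<cdot> v\<^sub>2 = c \<cdot> ((w\<^sub>2 \<cdot> u') \<cdot> e)" "c \<cdot> v\<^sub>1 = c \<cdot> v\<^sub>2"
    by (rule graph_confluent[of "w\<^sub>1' \<cdot> t'" "w\<^sub>2 \<cdot> u'" "Dom C t'", rotated 6]) (use that in simp_all)
  have cd: "c \<cdot> (w\<^sub>1 \<cdot> (t' \<cdot> e)) = d \<cdot> v\<^sub>1" "c \<cdot> (w\<^sub>2' \<cdot> (u' \<cdot> e)) = d \<cdot> v\<^sub>2"
    using v comp_eq_comp[OF w1(3), of "t' \<cdot> e"] comp_eq_comp[OF w2(3), of "u' \<cdot> e"] by simp_all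
  obtain s\<^sub>1 where [simp]: "s\<^sub>1 \<in> Arr C" "Dom C s\<^sub>1 = Dom C e" "Cod C s\<^sub>1 = D"
    and s1: "d \<cdot> s\<^sub>1 = d \<cdot> (w\<^sub>1 \<cdot> (t' \<cdot> e))" "c \<cdot> s\<^sub>1 = c \<cdot> v\<^sub>1"
    using graph_trans[of "w\<^sub>1 \<cdot> (t' \<cdot> e)" v\<^sub>1 "Dom C e"] cd(1) by auto
  obtain s\<^sub>2 where [simp]: "s\<^sub>2 \<in> Arr C" "Dom C s\<^sub>2 = Dom C e" "Cod C s\<^sub>2 = D"
    and s2: "d \<cdot> s\<^sub>2 = d \<cdot> (w\<^sub>2' \<cdot> (u' \<cdot> e))" "c \<cdot> s\<^sub>2 = c \<cdot> v\<^sub>2"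
    using graph_trans[of "w\<^sub>2' \<cdot> (u' \<cdot> e)" v\<^sub>2 "Dom C e"] cd(2) by auto
  note s = s1 s2
  show ?thesis
  proof (rule relI[of "t \<cdot> (t' \<cdot> e)" _ s\<^sub>1 s\<^sub>2])
    show "regular_epi C (t \<cdot> (t' \<cdot> e))" using t t' e by (simp add: regular_epi_comp)
    show "d \<cdot> s\<^sub>1 = x \<cdot> (t \<cdot> (t' \<cdot> e))" using s comp_eq_comp[OF w1(1), of "t' \<cdot> e"] by simp
    show "d \<cdot> s\<^sub>2 = z \<cdot> (t \<cdot> (t' \<cdot> e))"
      using s comp_eq_comp[OF w2(2), of "u' \<cdot> e"] comp_eq_comp[OF tu, of e] by simp
    show "c \<cdot> s\<^sub>1 = c \<cdot> s\<^sub>2" using s v by simp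
  qed simp_all
qed

text \<open>\<open>h\<close> takes equal values at the two ends of each leg of the valley, hence at
  \<open>x\<close> and \<open>y\<close> on a cover, and the cover is epic.\<close>

lemma rel_coequalized:
  assumes [simp]: "h \<in> Arr C" "Dom C h = A \<oplus> B" "x \<in> Arr C" "y \<in> Arr C" "Dom C x = Dom C y"
    "Cod C x = A \<oplus> B" "Cod C y = A \<oplus> B"
    and h: "h \<cdot> d = h \<cdot> c" and xy: "rel x y"
  shows "h \<cdot> x = h \<cdot> y"
proof -
  obtain t w w' where t: "regular_epi C t" and [simp]: "t \<in> Arr C" "Cod C t = Dom C y"
    "w \<in> Arr C" "w' \<in> Arr C" "Dom C w = Dom C t" "Dom C w' = Dom C t" "Cod C w = D" "Cod C w' = D"
    and w: "d \<cdot> w = x \<cdot> t" "d \<cdot> w' = y \<cdot> t" "c \<cdot> w = c \<cdot> w'"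
    by (rule relE[OF xy]) (use that in simp_all)
  have "(h \<cdot> x) \<cdot> t = (h \<cdot> y) \<cdot> t"
    using comp_eq_comp[OF h, of w] comp_eq_comp[OF h, of w'] w by simp
  thus ?thesis using regular_epi_cancel[OF t, of "h \<cdot> x" "h \<cdot> y"] by simp
qed

text \<open>Pairs of graph arrows with a common target form the kernel pair of \<open>c\<close>. The
  representing relation is the image of that kernel pair under \<open>d\<close>.\<close>

lemma rel_represented:
  obtains e\<^sub>1 e\<^sub>2 where "internal_relation C (A \<oplus> B) e\<^sub>1 e\<^sub>2"
    "e\<^sub>1 \<in> Arr C" "e\<^sub>2 \<in> Arr C" "Dom C e\<^sub>2 = Dom C e\<^sub>1" "Cod C e\<^sub>1 = A \<oplus> B" "Cod C e\<^sub>2 = A \<oplus> B"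
    "\<And>s. \<lbrakk>s \<in> Arr C; Cod C s = Dom C e\<^sub>1\<rbrakk> \<Longrightarrow> rel (e\<^sub>1 \<cdot> s) (e\<^sub>2 \<cdot> s)"
    "\<And>x y. \<lbrakk>x \<in> Arr C; y \<in> Arr C; Dom C x = Dom C y; Cod C x = A \<oplus> B; Cod C y = A \<oplus> B; rel x y\<rbrakk>
      \<Longrightarrow> \<exists>s. s \<in> hom C (Dom C x) (Dom C e\<^sub>1) \<and> e\<^sub>1 \<cdot> s = x \<and> e\<^sub>2 \<cdot> s = y"
proof -
  obtain g\<^sub>1 g\<^sub>2 where ker: "is_pullback C g\<^sub>1 g\<^sub>2 c c" using pullback_exists[of c c] by auto
  note [simp] = pullbackD(1,2,5)[OF ker]
  have [simp]: "Cod C g\<^sub>1 = D" "Cod C g\<^sub>2 = D" using pullbackD(6,7)[OF ker] by simp_all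
  obtain e e\<^sub>1 e\<^sub>2 where e: "regular_epi C e" and [simp]: "e \<in> Arr C" "e\<^sub>1 \<in> Arr C" "e\<^sub>2 \<in> Arr C"
    "Dom C e = Dom C g\<^sub>1" "Dom C e\<^sub>1 = Cod C e" "Dom C e\<^sub>2 = Cod C e" "Cod C e\<^sub>1 = A \<oplus> B" "Cod C e\<^sub>2 = A \<oplus> B"
    and de: "e\<^sub>1 \<cdot> e = d \<cdot> g\<^sub>1" "e\<^sub>2 \<cdot> e = d \<cdot> g\<^sub>2" and rel: "internal_relation C (A \<oplus> B) e\<^sub>1 e\<^sub>2"
    by (rule relation_image[of "d \<cdot> g\<^sub>1" "d \<cdot> g\<^sub>2" "Dom C g\<^sub>1" "A \<oplus> B"]) (use that in simp_all)
  have joint: "x = y" if "x \<in> Arr C" "y \<in> Arr C" "Dom C x = Dom C y" "Cod C x = Cod C e"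
    "Cod C y = Cod C e" "e\<^sub>1 \<cdot> x = e\<^sub>1 \<cdot> y" "e\<^sub>2 \<cdot> x = e\<^sub>2 \<cdot> y" for x y
    using rel that unfolding internal_relation_def hom_def by auto
  have 1: "rel (e\<^sub>1 \<cdot> s) (e\<^sub>2 \<cdot> s)" if [simp]: "s \<in> Arr C" "Cod C s = Dom C e\<^sub>1" for s
  proof -
    obtain t v where t: "regular_epi C t" and [simp]: "t \<in> Arr C" "v \<in> Arr C" "Cod C t = Dom C s"
        "Dom C v = Dom C t" "Cod C v = Dom C g\<^sub>1" and v: "e \<cdot> v = s \<cdot> t"
      using cover_lift[OF e, of s] by auto
    show ?thesis
      by (rule relI[OF t, of _ "g\<^sub>1 \<cdot> v" "g\<^sub>2 \<cdot> v"])
        (simp_all add: v comp_eq_comp[OF de(1)[symmetric]] comp_eq_comp[OF de(2)[symmetric]]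
          comp_eq_comp[OF pullbackD(9)[OF ker]])
  qed
  have 2: "\<exists>s. s \<in> hom C (Dom C x) (Dom C e\<^sub>1) \<and> e\<^sub>1 \<cdot> s = x \<and> e\<^sub>2 \<cdot> s = y"
    if x[simp]: "x \<in> Arr C" "y \<in> Arr C" "Dom C x = Dom C y" "Cod C x = A \<oplus> B" "Cod C y = A \<oplus> B"
      and xy: "rel x y" for x y
  proof -
    obtain t w w' where t: "regular_epi C t" and t_arr[simp]: "t \<in> Arr C" "Cod C t = Dom C y"
      "w \<in> Arr C" "w' \<in> Arr C" "Dom C w = Dom C t" "Dom C w' = Dom C t" "Cod C w = D" "Cod C w' = D"
      and w: "d \<cdot> w = x \<cdot> t" "d \<cdot> w' = y \<cdot> t" "c \<cdot> w = c \<cdot> w'"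
      by (rule relE[OF xy]) (use that in simp_all)
    obtain g where [simp]: "g \<in> Arr C" "Dom C g = Dom C t" "Cod C g = Dom C g\<^sub>1"
      and g: "g\<^sub>1 \<cdot> g = w" "g\<^sub>2 \<cdot> g = w'"
      using pullback_factor[OF ker, of w w'] w by auto
    have eg: "e\<^sub>1 \<cdot> (e \<cdot> g) = x \<cdot> t" "e\<^sub>2 \<cdot> (e \<cdot> g) = y \<cdot> t"
      using comp_eq_comp[OF de(1), of g] comp_eq_comp[OF de(2), of g] g w by simp_all
    \<comment> \<open>The local witness is constant on the fibres of the cover \<open>t\<close>,
      since both its components factor through \<open>t\<close> and the pair is jointly monic. So it
      descends along \<open>t\<close>.\<close>
    have "(e \<cdot> g) \<cdot> u = (e \<cdot> g) \<cdot> v" if "u \<in> Arr C" "v \<in> Arr C" "Dom C u = Dom C v"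
      "Cod C u = Dom C t" "Cod C v = Dom C t" "t \<cdot> u = t \<cdot> v" for u v
    proof (rule joint)
      show "e\<^sub>1 \<cdot> ((e \<cdot> g) \<cdot> u) = e\<^sub>1 \<cdot> ((e \<cdot> g) \<cdot> v)" "e\<^sub>2 \<cdot> ((e \<cdot> g) \<cdot> u) = e\<^sub>2 \<cdot> ((e \<cdot> g) \<cdot> v)"
        using comp_eq_comp[OF eg(1), of u] comp_eq_comp[OF eg(2), of u] comp_eq_comp[OF eg(1), of v]
          comp_eq_comp[OF eg(2), of v] that by simp_all
    qed (simp_all add: that)
    moreover have "e \<cdot> g \<in> Arr C" "Dom C (e \<cdot> g) = Dom C t" by simp_all
    ultimately obtain s where s[simp]: "s \<in> Arr C" "Dom C s = Cod C t" "Cod C s = Cod C (e \<cdot> g)"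
      and st: "s \<cdot> t = e \<cdot> g"
      using regular_epi_factor[OF t, of "e \<cdot> g"] by metis
    have [simp]: "Dom C s = Dom C y" "Cod C s = Cod C e" by simp_all
    have "(e\<^sub>1 \<cdot> s) \<cdot> t = x \<cdot> t" using eg by (simp add: st)
    hence 1: "e\<^sub>1 \<cdot> s = x" by (rule regular_epi_cancel[OF t, rotated -1]) simp_all
    have "(e\<^sub>2 \<cdot> s) \<cdot> t = y \<cdot> t" using eg by (simp add: st)
    hence 2: "e\<^sub>2 \<cdot> s = y" by (rule regular_epi_cancel[OF t, rotated -1]) simp_all
    show ?thesis using 1 2 by (intro exI[of _ s]) (simp add: hom_def)
  qed
  show ?thesis by (rule that[OF rel _ _ _ _ _ 1 2]) simp_all
qed

text \<open>Exactness yields some \<open>F\<close> with the right kernel pair, but nothing makes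
  \<open>F\<close> universal. Its kernel pair has a coequalizer \<open>q\<close>, and
  \<open>F\<close> factors through \<open>q\<close>, so \<open>q\<close> identifies no more elements
  than \<open>F\<close> does.\<close>

lemma quotient_exists:
  obtains q where "regular_epi C q" "q \<in> Arr C" "Dom C q = A \<oplus> B"
    "\<And>x y. \<lbrakk>x \<in> Arr C; y \<in> Arr C; Dom C x = Dom C y; Cod C x = A \<oplus> B; Cod C y = A \<oplus> B\<rbrakk>
      \<Longrightarrow> q \<cdot> x = q \<cdot> y \<longleftrightarrow> rel x y"
    "\<And>h. \<lbrakk>h \<in> Arr C; Dom C h = A \<oplus> B; h \<cdot> d = h \<cdot> c\<rbrakk>
      \<Longrightarrow> \<exists>k. k \<in> Arr C \<and> Dom C k = Cod C q \<and> Cod C k = Cod C h \<and> k \<cdot> q = h"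
proof -
  obtain e\<^sub>1 e\<^sub>2 where rel: "internal_relation C (A \<oplus> B) e\<^sub>1 e\<^sub>2"
    and [simp]: "e\<^sub>1 \<in> Arr C" "e\<^sub>2 \<in> Arr C" and e_dom[simp]: "Dom C e\<^sub>2 = Dom C e\<^sub>1"
    and [simp]: "Cod C e\<^sub>1 = A \<oplus> B" "Cod C e\<^sub>2 = A \<oplus> B"
    and rel_e: "\<And>s. \<lbrakk>s \<in> Arr C; Cod C s = Dom C e\<^sub>1\<rbrakk> \<Longrightarrow> rel (e\<^sub>1 \<cdot> s) (e\<^sub>2 \<cdot> s)"
    and e_rel: "\<And>x y. \<lbrakk>x \<in> Arr C; y \<in> Arr C; Dom C x = Dom C y; Cod C x = A \<oplus> B; Cod C y = A \<oplus> B; rel x y\<rbrakk>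
      \<Longrightarrow> \<exists>s. s \<in> hom C (Dom C x) (Dom C e\<^sub>1) \<and> e\<^sub>1 \<cdot> s = x \<and> e\<^sub>2 \<cdot> s = y"
    by (rule rel_represented, rule that)
  have rel_e12: "rel e\<^sub>1 e\<^sub>2" using rel_e[of "Id C (Dom C e\<^sub>1)"] by simp
  have "internal_equivalence C (A \<oplus> B) e\<^sub>1 e\<^sub>2"
    unfolding internal_equivalence_def
  proof (intro conjI allI impI)
    show "internal_relation C (A \<oplus> B) e\<^sub>1 e\<^sub>2" by (rule rel)
    show "\<exists>s\<in>hom C (A \<oplus> B) (Dom C e\<^sub>1). e\<^sub>1 \<cdot> s = Id C (A \<oplus> B) \<and> e\<^sub>2 \<cdot> s = Id C (A \<oplus> B)"
      using e_rel[OF _ _ _ _ _ rel_refl] by (simp add: Bex_def)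
    show "\<exists>s\<in>hom C (Dom C e\<^sub>1) (Dom C e\<^sub>1). e\<^sub>1 \<cdot> s = e\<^sub>2 \<and> e\<^sub>2 \<cdot> s = e\<^sub>1"
    proof -
      have "rel e\<^sub>2 e\<^sub>1" by (rule rel_sym[OF rel_e12]) simp
      hence "\<exists>s. s \<in> hom C (Dom C e\<^sub>2) (Dom C e\<^sub>1) \<and> e\<^sub>1 \<cdot> s = e\<^sub>2 \<and> e\<^sub>2 \<cdot> s = e\<^sub>1"
        by (rule e_rel[rotated -1]) simp_all
      thus ?thesis unfolding e_dom by blast
    qed
    fix p q assume pb: "is_pullback C p q e\<^sub>2 e\<^sub>1"
    note [simp] = pullbackD(1,2,5)[OF pb]
    have [simp]: "Cod C p = Dom C e\<^sub>1" "Cod C q = Dom C e\<^sub>1" using pullbackD(6,7)[OF pb] by simp_all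
    have "rel (e\<^sub>1 \<cdot> p) (e\<^sub>2 \<cdot> q)"
      using rel_trans[of "e\<^sub>1 \<cdot> p" "e\<^sub>2 \<cdot> p" "e\<^sub>2 \<cdot> q" "Dom C p"] rel_e[of p] rel_e[of q] pullbackD(9)[OF pb]
      by simp
    thus "\<exists>s\<in>hom C (Dom C p) (Dom C e\<^sub>1). e\<^sub>1 \<cdot> s = e\<^sub>1 \<cdot> p \<and> e\<^sub>2 \<cdot> s = e\<^sub>2 \<cdot> q"
      using e_rel[of "e\<^sub>1 \<cdot> p" "e\<^sub>2 \<cdot> q"] by (simp add: Bex_def)
  qed
  then obtain F where F: "is_pullback C e\<^sub>1 e\<^sub>2 F F"
    using exact unfolding exact_category_def kernel_pair_def by blast
  then obtain q where coeq: "is_coequalizer C e\<^sub>1 e\<^sub>2 q"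
    using kernel_pair_coequalizer[of F e\<^sub>1 e\<^sub>2] by (auto simp: kernel_pair_def)
  have q[simp]: "q \<in> Arr C" "Dom C q = A \<oplus> B" using coequalizerD(3,5)[OF coeq] by simp_all
  have F_arr[simp]: "F \<in> Arr C" "Dom C F = A \<oplus> B" using pullbackD(4,6)[OF F] by simp_all
  obtain k where [simp]: "k \<in> Arr C" "Dom C k = Cod C q" and k: "k \<cdot> q = F"
    using coequalizer_factor[OF coeq, of F] pullbackD(9)[OF F] by auto
  have 1: "q \<cdot> x = q \<cdot> y \<longleftrightarrow> rel x y" if [simp]: "x \<in> Arr C" "y \<in> Arr C" "Dom C x = Dom C y"
    "Cod C x = A \<oplus> B" "Cod C y = A \<oplus> B" for x y
  proof
    assume "q \<cdot> x = q \<cdot> y"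
    hence "F \<cdot> x = F \<cdot> y" using comp_eq_arr[OF k, of x] comp_eq_arr[OF k, of y] by simp
    then obtain s where "s \<in> Arr C" "Cod C s = Dom C e\<^sub>1" "e\<^sub>1 \<cdot> s = x" "e\<^sub>2 \<cdot> s = y"
      using pullback_factor[OF F, of x y] by auto
    thus "rel x y" using rel_e by blast
  next
    assume "rel x y"
    from e_rel[OF that this] obtain s
      where s: "s \<in> hom C (Dom C x) (Dom C e\<^sub>1)" "e\<^sub>1 \<cdot> s = x" "e\<^sub>2 \<cdot> s = y" by blast
    hence "s \<in> Arr C" "Cod C s = Dom C e\<^sub>1" by (simp_all add: hom_def)
    with s(2,3) show "q \<cdot> x = q \<cdot> y" using comp_eq_comp[OF coequalizerD(7)[OF coeq], of s] by simp
  qed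
  have 2: "\<exists>k. k \<in> Arr C \<and> Dom C k = Cod C q \<and> Cod C k = Cod C h \<and> k \<cdot> q = h"
    if "h \<in> Arr C" "Dom C h = A \<oplus> B" "h \<cdot> d = h \<cdot> c" for h
    using coequalizer_factor[OF coeq, of h] rel_coequalized[OF that(1,2) _ _ _ _ _ that(3) rel_e12] that
    by auto
  show ?thesis by (rule that[OF coequalizerD(8)[OF coeq] q 1 2])
qed

text \<open>\<open>g\<close> and \<open>n\<close> are the two components of the quotient map
  \<open>q\<close>. Both the monicity of \<open>n\<close> and the pullback property ask which
  elements are related to one of the form \<open>inr A B \<cdot> x\<close>, and saturation answers
  this.\<close>

lemma pushout_exists:
  "\<exists>g n. is_pushout C m f g n \<and> is_pullback C m f g n \<and> is_mono C n"
proof -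
  obtain q where q: "regular_epi C q" and [simp]: "q \<in> Arr C" "Dom C q = A \<oplus> B"
    and q_rel: "\<And>x y. \<lbrakk>x \<in> Arr C; y \<in> Arr C; Dom C x = Dom C y; Cod C x = A \<oplus> B; Cod C y = A \<oplus> B\<rbrakk>
      \<Longrightarrow> q \<cdot> x = q \<cdot> y \<longleftrightarrow> rel x y"
    and q_univ: "\<And>h. \<lbrakk>h \<in> Arr C; Dom C h = A \<oplus> B; h \<cdot> d = h \<cdot> c\<rbrakk>
      \<Longrightarrow> \<exists>k. k \<in> Arr C \<and> Dom C k = Cod C q \<and> Cod C k = Cod C h \<and> k \<cdot> q = h"
    by (rule quotient_exists, rule that)
  define g n where "g = q \<cdot> inl A B" and "n = q \<cdot> inr A B"
  have [simp]: "g \<in> Arr C" "Dom C g = A" "Cod C g = Cod C q" "n \<in> Arr C" "Dom C n = B" "Cod C n = Cod C q"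
    by (simp_all add: g_def n_def)
  \<comment> \<open>The graph arrow on the \<open>S\<close> summand alone goes from m s to f s; the
    second leg is the degenerate arrow at f s.\<close>
  have "rel (inl A B \<cdot> m) (inr A B \<cdot> f)"
    by (rule relI[of "Id C S" _ "inl (A \<oplus> S) B \<cdot> inr A S" "inr (A \<oplus> S) B \<cdot> f"])
      (simp_all add: regular_epi_id d_def c_def fsum_def)
  hence comm: "g \<cdot> m = n \<cdot> f" using q_rel[of "inl A B \<cdot> m" "inr A B \<cdot> f"] by (simp add: g_def n_def)
  \<comment> \<open>\<open>inr A B \<cdot> x\<close> is the image under \<open>\<mu>\<close> of
    \<open>inr S B \<cdot> x\<close>, on which \<open>r\<close> returns \<open>x\<close>; saturation
    carries both facts across the valley to \<open>y\<close>.\<close>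
  have saturated: "\<exists>t z. regular_epi C t \<and> t \<in> Arr C \<and> Cod C t = Dom C x \<and> z \<in> Arr C \<and>
      Dom C z = Dom C t \<and> Cod C z = S \<oplus> B \<and> \<mu> \<cdot> z = y \<cdot> t \<and> r \<cdot> z = x \<cdot> t"
    if [simp]: "x \<in> Arr C" "y \<in> Arr C" "Dom C x = Dom C y" "Cod C x = B" "Cod C y = A \<oplus> B"
      and xy: "rel (inr A B \<cdot> x) y" for x y
  proof -
    obtain t w w' where t: "regular_epi C t" and t_arr[simp]: "t \<in> Arr C" "Cod C t = Dom C y"
      "w \<in> Arr C" "w' \<in> Arr C" "Dom C w = Dom C t" "Dom C w' = Dom C t" "Cod C w = D" "Cod C w' = D"
      and w: "d \<cdot> w = (inr A B \<cdot> x) \<cdot> t" "d \<cdot> w' = y \<cdot> t" "c \<cdot> w = c \<cdot> w'"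
      by (rule relE[OF xy]) (use that in simp_all)
    have "d \<cdot> w = \<mu> \<cdot> (inr S B \<cdot> (x \<cdot> t))" using w by (simp add: \<mu>_def fsum_def)
    then obtain z where "z \<in> Arr C" "Dom C z = Dom C t" "Cod C z = S \<oplus> B" "d \<cdot> w' = \<mu> \<cdot> z"
      "r \<cdot> z = r \<cdot> (inr S B \<cdot> (x \<cdot> t))"
      by (rule saturation[of w w' "Dom C t" "inr S B \<cdot> (x \<cdot> t)", rotated 9]) (use that w in simp_all)
    thus ?thesis using t w(2) by (intro exI[of _ t] exI[of _ z]) (simp add: r_def)
  qed
  have "is_mono C n"
  proof (rule monoI)
    fix x y assume [simp]: "x \<in> Arr C" "y \<in> Arr C" "Dom C x = Dom C y" and "Cod C x = Dom C n"
      "Cod C y = Dom C n" and eq: "n \<cdot> x = n \<cdot> y"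
    hence [simp]: "Cod C x = B" "Cod C y = B" by simp_all
    have "rel (inr A B \<cdot> x) (inr A B \<cdot> y)"
      using q_rel[of "inr A B \<cdot> x" "inr A B \<cdot> y"] eq by (simp add: n_def)
    then obtain t z where t: "regular_epi C t" and [simp]: "t \<in> Arr C" "Cod C t = Dom C y" "z \<in> Arr C"
        "Dom C z = Dom C t" "Cod C z = S \<oplus> B"
      and z: "\<mu> \<cdot> z = (inr A B \<cdot> y) \<cdot> t" "r \<cdot> z = x \<cdot> t"
      using saturated[of x "inr A B \<cdot> y"] by auto
    have "\<mu> \<cdot> z = \<mu> \<cdot> (inr S B \<cdot> (y \<cdot> t))" using z by (simp add: \<mu>_def fsum_def)
    hence "z = inr S B \<cdot> (y \<cdot> t)" using monoD[OF mu_mono, of z "inr S B \<cdot> (y \<cdot> t)"] by simp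
    hence "x \<cdot> t = y \<cdot> t" using z(2) by (simp add: r_def)
    thus "x = y" by (rule regular_epi_cancel[OF t, rotated -1]) simp_all
  qed simp
  moreover have "is_pullback C m f g n"
  proof (rule pullbackI)
    fix x y assume [simp]: "x \<in> Arr C" "y \<in> Arr C" "Dom C x = Dom C y" and "Cod C x = Dom C g"
      "Cod C y = Dom C n" and eq: "g \<cdot> x = n \<cdot> y"
    hence [simp]: "Cod C x = A" "Cod C y = B" by simp_all
    have "rel (inr A B \<cdot> y) (inl A B \<cdot> x)"
      using q_rel[of "inr A B \<cdot> y" "inl A B \<cdot> x"] eq by (simp add: g_def n_def)
    then obtain t z where t: "regular_epi C t" and [simp]: "t \<in> Arr C" "Cod C t = Dom C y" "z \<in> Arr C"
        "Dom C z = Dom C t" "Cod C z = S \<oplus> B"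
      and z: "\<mu> \<cdot> z = (inl A B \<cdot> x) \<cdot> t" "r \<cdot> z = y \<cdot> t"
      using saturated[of y "inl A B \<cdot> x"] by auto
    \<comment> \<open>The element \<open>z\<close> lies in \<open>S \<oplus> B\<close> while its
      image lies in the summand \<open>A\<close>, so it comes from \<open>S\<close>. The resulting
      local solution descends along \<open>t\<close> because \<open>m\<close> is monic.\<close>
    obtain s where [simp]: "s \<in> Arr C" "Dom C s = Dom C t" "Cod C s = S"
      and s: "m \<cdot> s = x \<cdot> t" "inl S B \<cdot> s = z"
      using pullback_factor[OF pullback_inl_mu, of "x \<cdot> t" z] z(1) by auto
    obtain s\<^sub>0 where [simp]: "s\<^sub>0 \<in> Arr C" "Dom C s\<^sub>0 = Dom C y" "Cod C s\<^sub>0 = S"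
      and s\<^sub>0: "m \<cdot> s\<^sub>0 = x" "s\<^sub>0 \<cdot> t = s"
      using regular_epi_mono_lift[OF t m_mono, of x s] s(1) by auto
    have "f \<cdot> s = y \<cdot> t" using z(2) unfolding s(2)[symmetric] by (simp add: r_def)
    hence "(f \<cdot> s\<^sub>0) \<cdot> t = y \<cdot> t" by (simp add: s\<^sub>0)
    hence "f \<cdot> s\<^sub>0 = y" by (rule regular_epi_cancel[OF t, rotated -1]) simp_all
    thus "\<exists>h. h \<in> Arr C \<and> Dom C h = Dom C x \<and> Cod C h = Dom C m \<and> m \<cdot> h = x \<and> f \<cdot> h = y"
      using s\<^sub>0(1) by (intro exI[of _ s\<^sub>0]) simp
  next
    fix x y assume "x \<in> Arr C" "y \<in> Arr C" "Dom C x = Dom C y" "Cod C x = Dom C m" "Cod C y = Dom C m"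
      "m \<cdot> x = m \<cdot> y"
    thus "x = y" by (rule monoD[OF m_mono])
  qed (simp_all add: comm)
  moreover have "is_pushout C m f g n"
    unfolding is_pushout_def
  proof (intro conjI allI impI)
    show "comm_square C m f g n" by (simp add: comm_square_iff comm)
    fix u v assume "comm_square C m f u v"
    hence [simp]: "u \<in> Arr C" "v \<in> Arr C" "Dom C u = A" "Dom C v = B" "Cod C u = Cod C v"
      and uv: "u \<cdot> m = v \<cdot> f"
      by (simp_all add: comm_square_iff)
    have "(u \<nabla> v) \<cdot> d = (u \<nabla> v) \<cdot> c" by (simp add: d_def c_def fsum_def uv)
    then obtain k where [simp]: "k \<in> Arr C" "Dom C k = Cod C q" "Cod C k = Cod C v" and k: "k \<cdot> q = u \<nabla> v"
      using q_univ[of "u \<nabla> v"] by auto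
    have k': "k \<cdot> g = u" "k \<cdot> n = v"
      using comp_eq_arr[OF k, of "inl A B"] comp_eq_arr[OF k, of "inr A B"] by (simp_all add: g_def n_def)
    show "\<exists>!h. h \<in> hom C (Cod C g) (Cod C u) \<and> h \<cdot> g = u \<and> h \<cdot> n = v"
    proof (rule ex1I[of _ k])
      show "k \<in> hom C (Cod C g) (Cod C u) \<and> k \<cdot> g = u \<and> k \<cdot> n = v" using k' by (simp add: hom_def)
      fix h assume "h \<in> hom C (Cod C g) (Cod C u) \<and> h \<cdot> g = u \<and> h \<cdot> n = v"
      hence [simp]: "h \<in> Arr C" "Dom C h = Cod C q" "Cod C h = Cod C v" and h: "h \<cdot> g = u" "h \<cdot> n = v"
        by (simp_all add: hom_def)
      have "h \<cdot> q = k \<cdot> q"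
        by (rule coprod_cancel[of _ _ A B])
          (use h k' in \<open>simp_all add: g_def[symmetric] n_def[symmetric]\<close>)
      thus "h = k" by (rule regular_epi_cancel[OF q, rotated -1]) simp_all
    qed
  qed
  ultimately show ?thesis by blast
qed

end

text \<open>The construction treats one particular pushout. For an arbitrary one, the comparison
  arrow \<open>h\<close> into the constructed pushout suffices: \<open>n\<close> is monic because
  \<open>h \<cdot> n\<close> is, and an equation between \<open>g\<close> and \<open>n\<close>
  becomes, after applying \<open>h\<close>, one that the constructed pullback solves.\<close>

theorem proposition4p7:
  fixes C :: "('o, 'a) cat"
  assumes "exact_category C"
    and "condition_P C"
  shows "(\<forall>S A B m f. m \<in> hom C S A \<and> is_mono C m \<and> f \<in> hom C S B \<longrightarrow>
            (\<exists>g n. is_pushout C m f g n)) \<and>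
         (\<forall>m f g n. is_mono C m \<and> is_pushout C m f g n \<longrightarrow> is_pullback C m f g n) \<and>
         (\<forall>m f g n. is_mono C m \<and> is_pushout C m f g n \<longrightarrow> is_mono C n)"
proof -
  have "regular_category C" using assms(1) by (simp add: exact_category_def)
  interpret category C using \<open>regular_category C\<close> by (simp add: regular_category_def)
  interpret condition_P_cat C by unfold_locales fact+
  have ex: "\<exists>g n. is_pushout C m f g n \<and> is_pullback C m f g n \<and> is_mono C n"
    if "m \<in> hom C S A" "is_mono C m" "f \<in> hom C S B" for S A B m f
  proof -
    interpret mono_span C S A B m f by unfold_locales (fact assms(1) that)+
    show ?thesis by (rule pushout_exists)
  qed
  have "is_pullback C m f g n \<and> is_mono C n" if m: "is_mono C m" and po: "is_pushout C m f g n" for m f g n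
  proof -
    have sq: "comm_square C m f g n" using po by (simp add: is_pushout_def)
    hence arr[simp]: "m \<in> Arr C" "f \<in> Arr C" "g \<in> Arr C" "n \<in> Arr C" "Dom C f = Dom C m"
      "Dom C g = Cod C m" "Dom C n = Cod C f" "Cod C g = Cod C n" and comm: "g \<cdot>\<^bsub>C\<^esub> m = n \<cdot>\<^bsub>C\<^esub> f"
      by (simp_all add: comm_square_iff)
    obtain g\<^sub>0 n\<^sub>0 where "is_pushout C m f g\<^sub>0 n\<^sub>0" and pb: "is_pullback C m f g\<^sub>0 n\<^sub>0" and mono: "is_mono C n\<^sub>0"
      using ex[of m "Dom C m" "Cod C m" f "Cod C f"] m by (auto simp: hom_def)
    hence "comm_square C m f g\<^sub>0 n\<^sub>0" by (simp add: is_pushout_def)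
    with po have "\<exists>!h. h \<in> hom C (Cod C g) (Cod C g\<^sub>0) \<and> h \<cdot>\<^bsub>C\<^esub> g = g\<^sub>0 \<and> h \<cdot>\<^bsub>C\<^esub> n = n\<^sub>0"
      by (simp add: is_pushout_def)
    then obtain h where [simp]: "h \<in> Arr C" "Dom C h = Cod C n" and h: "h \<cdot>\<^bsub>C\<^esub> g = g\<^sub>0" "h \<cdot>\<^bsub>C\<^esub> n = n\<^sub>0"
      by (auto simp: hom_def)
    have "is_mono C n"
    proof (rule monoI)
      fix x y assume xy: "x \<in> Arr C" "y \<in> Arr C" "Dom C x = Dom C y" "Cod C x = Dom C n"
        "Cod C y = Dom C n" "n \<cdot>\<^bsub>C\<^esub> x = n \<cdot>\<^bsub>C\<^esub> y"
      have "n\<^sub>0 \<cdot>\<^bsub>C\<^esub> x = n\<^sub>0 \<cdot>\<^bsub>C\<^esub> y" using xy comp_eq_arr[OF h(2), of x] comp_eq_arr[OF h(2), of y] by simp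
      moreover have "Dom C n\<^sub>0 = Dom C n" unfolding h(2)[symmetric] by simp
      ultimately show "x = y" using monoD[OF mono xy(1-3)] xy by simp
    qed simp
    moreover have "is_pullback C m f g n"
    proof (rule pullbackI)
      fix u v assume uv: "u \<in> Arr C" "v \<in> Arr C" "Dom C u = Dom C v" "Cod C u = Dom C g"
        "Cod C v = Dom C n" "g \<cdot>\<^bsub>C\<^esub> u = n \<cdot>\<^bsub>C\<^esub> v"
      have "g\<^sub>0 \<cdot>\<^bsub>C\<^esub> u = n\<^sub>0 \<cdot>\<^bsub>C\<^esub> v" using uv comp_eq_arr[OF h(1), of u] comp_eq_arr[OF h(2), of v] by simp
      moreover have "Cod C u = Dom C g\<^sub>0" "Cod C v = Dom C n\<^sub>0" using uv unfolding h[symmetric] by simp_all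
      ultimately obtain k where "k \<in> Arr C" "Dom C k = Dom C u" "Cod C k = Dom C m"
        "m \<cdot>\<^bsub>C\<^esub> k = u" "f \<cdot>\<^bsub>C\<^esub> k = v"
        using pullback_factor[OF pb uv(1-3)] by metis
      thus "\<exists>k. k \<in> Arr C \<and> Dom C k = Dom C u \<and> Cod C k = Dom C m \<and> m \<cdot>\<^bsub>C\<^esub> k = u \<and> f \<cdot>\<^bsub>C\<^esub> k = v"
        by blast
    next
      fix x y assume "x \<in> Arr C" "y \<in> Arr C" "Dom C x = Dom C y" "Cod C x = Dom C m"
        "Cod C y = Dom C m" "m \<cdot>\<^bsub>C\<^esub> x = m \<cdot>\<^bsub>C\<^esub> y"
      thus "x = y" by (rule monoD[OF m])
    qed (simp_all add: comm)
    ultimately show ?thesis by blast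
  qed
  with ex show ?thesis by blast
qed

end
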